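(* Let $(M,F)$ be a Finsler manifold. The Lie derivatives of the two Ricci tensors $Ric_{ij}$ and $\tilde R_{ij}$ coincide along $\mathbf I$-projective vector fields; that is, for every $\mathbf I$-projective vector field $X$ on $(M,F)$, $$\pounds_{\hat X}Ric_{ij}=\pounds_{\hat X}\tilde R_{ij}.$$
   Context: $M$ is an $n$-dimensional smooth manifold, $TM_0=TM\setminus\{0\}$ with induced coordinates $(x^i,y^i)$. A Finsler structure is a continuous $F:TM\to[0,\infty)$, smooth on $TM_0$, positively 1-homogeneous on fibers, with $g_{ij}=\left(\tfrac12F^2\right)_{y^iy^j}$ positive definite on $TM_0$; $(g^{ij})$ is the inverse matrix. Spray coefficients: $G^i=\frac14 g^{il}\{[F^2]_{x^ky^l}y^k-[F^2]_{x^l}\}$; $G^i_j=\frac{\partial G^i}{\partial y^j}$, $G^i_{jk}=\frac{\partial G^i_j}{\partial y^k}$, $\delta_i=\frac{\partial}{\partial x^i}-G^j_i\frac{\partial}{\partial y^j}$. The $hh$-curvature of the Berwald connection is $K^i_{jkl}=\delta_kG^i_{jl}-\delta_lG^i_{jk}+G^i_{rk}G^r_{jl}-G^i_{rl}G^r_{jk}$, with contraction $K_{jl}=K^m_{jml}$. First Akbar-Zadeh Ricci tensor: $\tilde R_{ij}=\frac12(K_{ij}+K_{ji})$. Second Akbar-Zadeh Ricci tensor: $Ric_{ij}=\frac12\frac{\partial^2(R^m{}_m)}{\partial y^i\partial y^j}$, where $R^i{}_k=2\frac{\partial G^i}{\partial x^k}-\frac{\partial^2G^i}{\partial x^j\partial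 y^k}y^j+2G^j\frac{\partial^2G^i}{\partial y^j\partial y^k}-\frac{\partial G^i}{\partial y^j}\frac{\partial G^j}{\partial y^k}$ (so $R^m{}_m=K_{ij}y^iy^j$). For a vector field $X=X^i(x)\frac{\partial}{\partial x^i}$ on $M$, its complete lift is $\hat X=X^i\frac{\partial}{\partial x^i}+y^k\frac{\partial X^i}{\partial x^k}\frac{\partial}{\partial y^i}$ on $TM_0$, and $\pounds_{\hat X}$ denotes the Lie derivative along $\hat X$ of objects depending on $(x,y)$; e.g. $\pounds_{\hat X}G^i=\hat X(G^i)-G^j\frac{\partial X^i}{\partial x^j}+\frac12y^jy^k\frac{\partial^2X^i}{\partial x^j\partial x^k}$, $\pounds_{\hat X}T_k=\hat X(T_k)+T_j\frac{\partial X^j}{\partial x^k}$, and similarly for each covariant index of a tensor. $X$ is projective if its local flow maps geodesics to geodesics (as oriented point sets), equivalently if $\pounds_{\hat X}G^i=\Psi y^i$ for a function $\Psi(x,y)$ on $TM_0$, positively 1-homogeneous in $y$. The mean Cartan torsion $\mathbf I$ has components $I_i=\frac12g^{jk}\frac{\partial g_{jk}}{\partial y^i}$. A projective vector field $X$ is $\mathbf I$-projective if $\pounds_{\hat X}\mathbf I=0$. *)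

theory Defs
  imports "HOL-Analysis.Analysis"
begin

section \<open>Smooth functions on open sets\<close>

text \<open>All sets \<open>S\<close> to which this is applied are open, so \<open>at x\<close> is the appropriate filter.\<close>

fun Ck_on :: "nat \<Rightarrow> 'a::real_normed_vector set \<Rightarrow> ('a \<Rightarrow> 'b::real_normed_vector) \<Rightarrow> bool"
  where
    "Ck_on 0 S f \<longleftrightarrow> continuous_on S f"
  | "Ck_on (Suc k) S f \<longleftrightarrow>
       (\<forall>x\<in>S. f differentiable (at x)) \<and>
       (\<forall>v. Ck_on k S (\<lambda>x. frechet_derivative f (at x) v))"

definition smooth_on :: "'a::real_normed_vector set \<Rightarrow> ('a \<Rightarrow> 'b::real_normed_vector) \<Rightarrow> bool"
  where "smooth_on S f \<longleftrightarrow> (\<forall>k. Ck_on k S f)"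


section \<open>Smooth manifolds and their tangent bundles\<close>

text \<open>A chart is a pair of its domain and its coordinate map. The dimension of the manifold is
  \<open>CARD('n)\<close>.\<close>

type_synonym ('m, 'n) chart = "'m set \<times> ('m \<Rightarrow> real ^ 'n)"

definition chart_image :: "('m, 'n::finite) chart \<Rightarrow> (real ^ 'n) set"
  where "chart_image c = snd c ` fst c"

definition chart_point :: "('m, 'n::finite) chart \<Rightarrow> real ^ 'n \<Rightarrow> 'm"
  where "chart_point c = inv_into (fst c) (snd c)"

definition transition ::
    "('m, 'n::finite) chart \<Rightarrow> ('m, 'n) chart \<Rightarrow> real ^ 'n \<Rightarrow> real ^ 'n"
  where "transition c d = snd d \<circ> chart_point c"

definition is_chart :: "'m topology \<Rightarrow> ('m, 'n::finite) chart \<Rightarrow> bool"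
  where "is_chart M c \<longleftrightarrow>
    openin M (fst c) \<and> open (chart_image c) \<and>
    homeomorphic_map (subtopology M (fst c)) (top_of_set (chart_image c)) (snd c)"

definition smooth_manifold :: "'m topology \<Rightarrow> ('m, 'n::finite) chart set \<Rightarrow> bool"
  where "smooth_manifold M A \<longleftrightarrow>
    Hausdorff_space M \<and> second_countable M \<and>
    (\<forall>c\<in>A. is_chart M c) \<and> (\<Union>c\<in>A. fst c) = topspace M \<and>
    (\<forall>c\<in>A. \<forall>d\<in>A. smooth_on (snd c ` (fst c \<inter> fst d)) (transition c d))"

text \<open>A tangent vector at \<open>p\<close> is given by its components in all charts around \<open>p\<close>, which
  transform by the Jacobians of the coordinate changes. The components in the other charts carry
  no information and are set to \<open>0\<close>.\<close>

type_synonym ('m, 'n) tvec = "('m, 'n) chart \<Rightarrow> real ^ 'n"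

definition tangent_space :: "('m, 'n::finite) chart set \<Rightarrow> 'm \<Rightarrow> ('m, 'n) tvec set"
  where "tangent_space A p = {v.
    (\<forall>c\<in>A. \<forall>d\<in>A. p \<in> fst c \<and> p \<in> fst d \<longrightarrow>
       v d = frechet_derivative (transition c d) (at (snd c p)) (v c)) \<and>
    (\<forall>c. \<not> (c \<in> A \<and> p \<in> fst c) \<longrightarrow> v c = 0)}"

definition tangent_bundle ::
    "'m topology \<Rightarrow> ('m, 'n::finite) chart set \<Rightarrow> ('m \<times> ('m, 'n) tvec) set"
  where "tangent_bundle M A = Sigma (topspace M) (tangent_space A)"

definition slit_tangent_bundle ::
    "'m topology \<Rightarrow> ('m, 'n::finite) chart set \<Rightarrow> ('m \<times> ('m, 'n) tvec) set"
  where "slit_tangent_bundle M A = {(p, v) \<in> tangent_bundle M A. v \<noteq> (\<lambda>_. 0)}"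

definition scale_tvec :: "real \<Rightarrow> ('m, 'n::finite) tvec \<Rightarrow> ('m, 'n) tvec"
  where "scale_tvec s v = (\<lambda>c. s *\<^sub>R v c)"

text \<open>The point of the tangent bundle with induced coordinates \<open>(x, y)\<close> in the chart \<open>c\<close>.\<close>

definition bundle_point ::
    "('m, 'n::finite) chart set \<Rightarrow> ('m, 'n) chart \<Rightarrow> (real ^ 'n) \<times> (real ^ 'n)
      \<Rightarrow> 'm \<times> ('m, 'n) tvec"
  where "bundle_point A c z =
    (chart_point c (fst z),
     \<lambda>d. if d \<in> A \<and> chart_point c (fst z) \<in> fst d
          then frechet_derivative (transition c d) (at (fst z)) (snd z) else 0)"

text \<open>\<open>bundle_point A c\<close> is a bijection from the induced coordinates onto the part of the tangent
  bundle over the chart domain, with inverse \<open>(p, v) \<mapsto> (snd c p, v c)\<close>.\<close>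

lemma chart_point_simps: assumes "is_chart M c" shows
  "p \<in> fst c \<Longrightarrow> chart_point c (snd c p) = p" "p \<in> fst c \<Longrightarrow> snd c p \<in> chart_image c"
  "x \<in> chart_image c \<Longrightarrow> snd c (chart_point c x) = x" "x \<in> chart_image c \<Longrightarrow> chart_point c x \<in> fst c"
proof -
  have sub: "fst c \<subseteq> topspace M" using assms openin_subset unfolding is_chart_def by blast
  have "inj_on (snd c) (fst c)" using assms sub unfolding is_chart_def homeomorphic_map_def
    by (simp add: Int_absorb1)
  then show "p \<in> fst c \<Longrightarrow> chart_point c (snd c p) = p" by (simp add: chart_point_def)
  show "p \<in> fst c \<Longrightarrow> snd c p \<in> chart_image c" by (simp add: chart_image_def)
  show "x \<in> chart_image c \<Longrightarrow> snd c (chart_point c x) = x" "x \<in> chart_image c \<Longrightarrow> chart_point c x \<in> fst c"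
    by (auto simp: chart_image_def chart_point_def f_inv_into_f inv_into_into)
qed

lemma open_chart_overlap: assumes "is_chart M c" "openin M W"
  shows "open (snd c ` (fst c \<inter> W))"
proof -
  have "openin (subtopology M (fst c)) (fst c \<inter> W)"
    using assms(2) openin_subtopology_Int2 by blast
  moreover have "open_map (subtopology M (fst c)) (top_of_set (chart_image c)) (snd c)"
    using assms(1) homeomorphic_imp_open_map unfolding is_chart_def by blast
  ultimately have "openin (top_of_set (chart_image c)) (snd c ` (fst c \<inter> W))"
    by (auto simp: open_map_def)
  then show ?thesis using assms(1) unfolding is_chart_def
    using openin_open_trans by blast
qed

lemma transition_differentiable: assumes "smooth_manifold M A" "c \<in> A" "d \<in> A" "p \<in> fst c" "p \<in> fst d"
  shows "transition c d differentiable (at (snd c p))"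
proof -
  have "Ck_on (Suc 0) (snd c ` (fst c \<inter> fst d)) (transition c d)"
    using assms unfolding smooth_manifold_def smooth_on_def by blast
  then show ?thesis using assms by auto
qed

lemma bundle_point_coord:
  assumes "smooth_manifold M A" "c \<in> A" "x \<in> chart_image c"
  shows "snd (bundle_point A c (x, y)) c = y"
    and "bundle_point A c (x, y) \<in> tangent_bundle M A"
proof -
  have ch: "\<And>c. c \<in> A \<Longrightarrow> is_chart M c" using assms(1) by (auto simp: smooth_manifold_def)
  note cpc = chart_point_simps[OF ch[OF assms(2)]]
  have oc: "open (chart_image c)" using ch[OF assms(2)] by (simp add: is_chart_def)
  have id: "(transition c c has_derivative (\<lambda>h. h)) (at x)"
    by (rule has_derivative_transform_within_open[where f="\<lambda>x. x", OF _ oc assms(3)])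
       (auto simp: transition_def cpc)
  then have "frechet_derivative (transition c c) (at x) = (\<lambda>h. h)"
    using frechet_derivative_at by metis
  then show "snd (bundle_point A c (x, y)) c = y"
    using assms(2,3) cpc by (simp add: bundle_point_def)
  define p where "p = chart_point c x"
  have pc: "p \<in> fst c" and px: "snd c p = x" using cpc assms(3) by (auto simp: p_def)
  have key: "frechet_derivative (transition c e) (at x) y =
    frechet_derivative (transition d e) (at (snd d p)) (frechet_derivative (transition c d) (at x) y)"
    if "d \<in> A" "e \<in> A" "p \<in> fst d" "p \<in> fst e" for d e
  proof -
    have xp: "transition c d x = snd d p" by (simp add: transition_def p_def)
    have D1: "(transition c d has_derivative frechet_derivative (transition c d) (at x)) (at x)"
      using transition_differentiable[OF assms(1,2) that(1) pc that(3)] frechet_derivative_works px by metis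
    have D2: "(transition d e has_derivative frechet_derivative (transition d e) (at (snd d p))) (at (transition c d x))"
      using transition_differentiable[OF assms(1) that(1,2,3,4)] frechet_derivative_works xp by metis
    have D: "(transition d e \<circ> transition c d has_derivative
       frechet_derivative (transition d e) (at (snd d p)) \<circ> frechet_derivative (transition c d) (at x)) (at x)"
      using diff_chain_at[OF D1 D2] .
    have oo: "open (snd c ` (fst c \<inter> fst d))"
      using open_chart_overlap ch assms(2) that(1) unfolding is_chart_def by blast
    have xin: "x \<in> snd c ` (fst c \<inter> fst d)" using pc px that(3) by blast
    have "(transition c e has_derivative
       frechet_derivative (transition d e) (at (snd d p)) \<circ> frechet_derivative (transition c d) (at x)) (at x)"
      by (rule has_derivative_transform_within_open[OF D oo xin])
         (auto simp: transition_def cpc chart_point_simps[OF ch[OF that(1)]])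
    then show ?thesis using frechet_derivative_at by (metis comp_apply)
  qed
  have "p \<in> topspace M" using ch[OF assms(2)] pc openin_subset unfolding is_chart_def by blast
  moreover have "(\<lambda>d. if d \<in> A \<and> p \<in> fst d then frechet_derivative (transition c d) (at x) y else 0) \<in> tangent_space A p"
    unfolding tangent_space_def
  proof (intro CollectI conjI ballI impI allI)
    fix d e assume "d \<in> A" "e \<in> A" "p \<in> fst d \<and> p \<in> fst e"
    then show "(if e \<in> A \<and> p \<in> fst e then frechet_derivative (transition c e) (at x) y else 0) =
      frechet_derivative (transition d e) (at (snd d p)) (if d \<in> A \<and> p \<in> fst d then frechet_derivative (transition c d) (at x) y else 0)"
      using key[of d e] by (simp only: simp_thms if_True)
  qed (simp only: if_False simp_thms)
  ultimately show "bundle_point A c (x, y) \<in> tangent_bundle M A"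
    unfolding bundle_point_def tangent_bundle_def fst_conv snd_conv p_def by (rule SigmaI)
qed

lemma bundle_point_surj:
  assumes "smooth_manifold M A" "c \<in> A" "(p, v) \<in> tangent_bundle M A" "p \<in> fst c"
  shows "bundle_point A c (snd c p, v c) = (p, v)"
proof -
  have c: "is_chart M c" using assms by (auto simp: smooth_manifold_def)
  have m: "v \<in> tangent_space A p" using assms(3) by (simp add: tangent_bundle_def)
  have m1: "\<forall>c\<in>A. \<forall>d\<in>A. p \<in> fst c \<and> p \<in> fst d \<longrightarrow>
       v d = frechet_derivative (transition c d) (at (snd c p)) (v c)"
    using m unfolding tangent_space_def by (elim CollectE conjE)
  have m2: "\<forall>c. \<not> (c \<in> A \<and> p \<in> fst c) \<longrightarrow> v c = 0"
    using m unfolding tangent_space_def by (elim CollectE conjE)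
  have "(if d \<in> A \<and> p \<in> fst d then frechet_derivative (transition c d) (at (snd c p)) (v c) else 0) = v d" for d
  proof (cases "d \<in> A \<and> p \<in> fst d")
    case True
    then have "v d = frechet_derivative (transition c d) (at (snd c p)) (v c)"
      using m1[rule_format, OF assms(2), of d] assms(4) by argo
    then show ?thesis using True by presburger
  next
    case False then show ?thesis using m2 by presburger
  qed
  then show ?thesis unfolding bundle_point_def fst_conv snd_conv chart_point_simps(1)[OF c assms(4)] by presburger
qed

definition bundle_coords :: "('m, 'n::finite) chart \<Rightarrow> ((real ^ 'n) \<times> (real ^ 'n)) set"
  where "bundle_coords c = chart_image c \<times> UNIV"

definition slit_coords :: "('m, 'n::finite) chart \<Rightarrow> ((real ^ 'n) \<times> (real ^ 'n)) set"
  where "slit_coords c = chart_image c \<times> (UNIV - {0})"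

definition local_rep ::
    "('m, 'n::finite) chart set \<Rightarrow> ('m, 'n) chart \<Rightarrow> ('m \<times> ('m, 'n) tvec \<Rightarrow> real)
      \<Rightarrow> (real ^ 'n) \<times> (real ^ 'n) \<Rightarrow> real"
  where "local_rep A c f = (\<lambda>z. f (bundle_point A c z))"

definition field_rep ::
    "('m, 'n::finite) chart \<Rightarrow> ('m \<Rightarrow> ('m, 'n) tvec) \<Rightarrow> real ^ 'n \<Rightarrow> real ^ 'n"
  where "field_rep c X = (\<lambda>x. X (chart_point c x) c)"

definition smooth_vector_field ::
    "'m topology \<Rightarrow> ('m, 'n::finite) chart set \<Rightarrow> ('m \<Rightarrow> ('m, 'n) tvec) \<Rightarrow> bool"
  where "smooth_vector_field M A X \<longleftrightarrow>
    (\<forall>p\<in>topspace M. X p \<in> tangent_space A p) \<and>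
    (\<forall>c\<in>A. smooth_on (chart_image c) (field_rep c X))"


section \<open>Finsler geometry in induced coordinates\<close>

text \<open>In this section \<open>F\<close> is the expression of a Finsler structure in induced coordinates
  \<open>z = (x, y)\<close>, and upper and lower tensor indices are the arguments of type \<open>'n\<close>, from left to
  right.\<close>

definition dx :: "'n \<Rightarrow> ((real ^ 'n) \<times> (real ^ 'n) \<Rightarrow> real) \<Rightarrow> (real ^ 'n::finite) \<times> (real ^ 'n) \<Rightarrow> real"
  where "dx i f z = frechet_derivative f (at z) (axis i 1, 0)"

definition dy :: "'n \<Rightarrow> ((real ^ 'n) \<times> (real ^ 'n) \<Rightarrow> real) \<Rightarrow> (real ^ 'n::finite) \<times> (real ^ 'n) \<Rightarrow> real"
  where "dy i f z = frechet_derivative f (at z) (0, axis i 1)"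

context
  fixes F :: "(real ^ 'n::finite) \<times> (real ^ 'n) \<Rightarrow> real"
begin

definition fund :: "'n \<Rightarrow> 'n \<Rightarrow> (real ^ 'n) \<times> (real ^ 'n) \<Rightarrow> real"
  where "fund i j = dy j (dy i (\<lambda>z. 1/2 * (F z)\<^sup>2))"

definition fund_inv :: "'n \<Rightarrow> 'n \<Rightarrow> (real ^ 'n) \<times> (real ^ 'n) \<Rightarrow> real"
  where "fund_inv i j z = matrix_inv (\<chi> k l. fund k l z) $ i $ j"

definition spray :: "'n \<Rightarrow> (real ^ 'n) \<times> (real ^ 'n) \<Rightarrow> real"
  where "spray i z = 1/4 * (\<Sum>l\<in>UNIV. fund_inv i l z *
    ((\<Sum>k\<in>UNIV. dy l (dx k (\<lambda>w. (F w)\<^sup>2)) z * snd z $ k) - dx l (\<lambda>w. (F w)\<^sup>2) z))"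

definition spray1 :: "'n \<Rightarrow> 'n \<Rightarrow> (real ^ 'n) \<times> (real ^ 'n) \<Rightarrow> real"
  where "spray1 i j = dy j (spray i)"

definition spray2 :: "'n \<Rightarrow> 'n \<Rightarrow> 'n \<Rightarrow> (real ^ 'n) \<times> (real ^ 'n) \<Rightarrow> real"
  where "spray2 i j k = dy k (spray1 i j)"

definition hderiv ::
    "'n \<Rightarrow> ((real ^ 'n) \<times> (real ^ 'n) \<Rightarrow> real) \<Rightarrow> (real ^ 'n) \<times> (real ^ 'n) \<Rightarrow> real"
  where "hderiv i f z = dx i f z - (\<Sum>j\<in>UNIV. spray1 j i z * dy j f z)"

definition berwald_curv :: "'n \<Rightarrow> 'n \<Rightarrow> 'n \<Rightarrow> 'n \<Rightarrow> (real ^ 'n) \<times> (real ^ 'n) \<Rightarrow> real"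
  where "berwald_curv i j k l z =
    hderiv k (spray2 i j l) z - hderiv l (spray2 i j k) z
    + (\<Sum>r\<in>UNIV. spray2 i r k z * spray2 r j l z)
    - (\<Sum>r\<in>UNIV. spray2 i r l z * spray2 r j k z)"

definition berwald_contr :: "'n \<Rightarrow> 'n \<Rightarrow> (real ^ 'n) \<times> (real ^ 'n) \<Rightarrow> real"
  where "berwald_contr j l z = (\<Sum>m\<in>UNIV. berwald_curv m j m l z)"

definition first_Ricci :: "'n \<Rightarrow> 'n \<Rightarrow> (real ^ 'n) \<times> (real ^ 'n) \<Rightarrow> real"
  where "first_Ricci i j z = 1/2 * (berwald_contr i j z + berwald_contr j i z)"

definition riemann_curv :: "'n \<Rightarrow> 'n \<Rightarrow> (real ^ 'n) \<times> (real ^ 'n) \<Rightarrow> real"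
  where "riemann_curv i k z =
    2 * dx k (spray i) z
    - (\<Sum>j\<in>UNIV. dx j (dy k (spray i)) z * snd z $ j)
    + 2 * (\<Sum>j\<in>UNIV. spray j z * dy j (dy k (spray i)) z)
    - (\<Sum>j\<in>UNIV. dy j (spray i) z * dy k (spray j) z)"

definition second_Ricci :: "'n \<Rightarrow> 'n \<Rightarrow> (real ^ 'n) \<times> (real ^ 'n) \<Rightarrow> real"
  where "second_Ricci i j z = 1/2 * dy i (dy j (\<lambda>w. \<Sum>m\<in>UNIV. riemann_curv m m w)) z"

definition mean_Cartan :: "'n \<Rightarrow> (real ^ 'n) \<times> (real ^ 'n) \<Rightarrow> real"
  where "mean_Cartan i z = 1/2 * (\<Sum>j\<in>UNIV. \<Sum>k\<in>UNIV. fund_inv j k z * dy i (fund j k) z)"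

end


section \<open>Lie derivatives along complete lifts\<close>

text \<open>Here \<open>X\<close> is the coordinate expression of a vector field on the manifold.\<close>

definition pderiv_at :: "'n \<Rightarrow> (real ^ 'n \<Rightarrow> real) \<Rightarrow> real ^ 'n::finite \<Rightarrow> real"
  where "pderiv_at k f x = frechet_derivative f (at x) (axis k 1)"

context
  fixes X :: "real ^ 'n \<Rightarrow> real ^ 'n::finite"
begin

definition complete_lift :: "((real ^ 'n) \<times> (real ^ 'n) \<Rightarrow> real) \<Rightarrow> (real ^ 'n) \<times> (real ^ 'n) \<Rightarrow> real"
  where "complete_lift f z =
    (\<Sum>i\<in>UNIV. X (fst z) $ i * dx i f z)
    + (\<Sum>i\<in>UNIV. \<Sum>k\<in>UNIV. snd z $ k * pderiv_at k (\<lambda>x. X x $ i) (fst z) * dy i f z)"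

text \<open>The spray coefficients do not form a tensor: the Hessian of \<open>X\<close> comes from their inhomogeneous
  transformation law.\<close>

definition lie_spray ::
    "('n \<Rightarrow> (real ^ 'n) \<times> (real ^ 'n) \<Rightarrow> real) \<Rightarrow> 'n \<Rightarrow> (real ^ 'n) \<times> (real ^ 'n) \<Rightarrow> real"
  where "lie_spray G i z =
    complete_lift (G i) z
    - (\<Sum>j\<in>UNIV. G j z * pderiv_at j (\<lambda>x. X x $ i) (fst z))
    + 1/2 * (\<Sum>j\<in>UNIV. \<Sum>k\<in>UNIV. snd z $ j * snd z $ k *
        pderiv_at j (pderiv_at k (\<lambda>x. X x $ i)) (fst z))"

definition lie_covector ::
    "('n \<Rightarrow> (real ^ 'n) \<times> (real ^ 'n) \<Rightarrow> real) \<Rightarrow> 'n \<Rightarrow> (real ^ 'n) \<times> (real ^ 'n) \<Rightarrow> real"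
  where "lie_covector T k z =
    complete_lift (T k) z + (\<Sum>j\<in>UNIV. T j z * pderiv_at k (\<lambda>x. X x $ j) (fst z))"

definition lie_bilinear ::
    "('n \<Rightarrow> 'n \<Rightarrow> (real ^ 'n) \<times> (real ^ 'n) \<Rightarrow> real) \<Rightarrow> 'n \<Rightarrow> 'n
      \<Rightarrow> (real ^ 'n) \<times> (real ^ 'n) \<Rightarrow> real"
  where "lie_bilinear T i j z =
    complete_lift (T i j) z
    + (\<Sum>r\<in>UNIV. T r j z * pderiv_at i (\<lambda>x. X x $ r) (fst z))
    + (\<Sum>r\<in>UNIV. T i r z * pderiv_at j (\<lambda>x. X x $ r) (fst z))"

end


section \<open>Finsler structures and projective vector fields\<close>

definition finsler_structure ::
    "'m topology \<Rightarrow> ('m, 'n::finite) chart set \<Rightarrow> ('m \<times> ('m, 'n) tvec \<Rightarrow> real) \<Rightarrow> bool"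
  where "finsler_structure M A F \<longleftrightarrow>
    (\<forall>u\<in>tangent_bundle M A. F u \<ge> 0) \<and>
    (\<forall>(p, v)\<in>tangent_bundle M A. \<forall>s>0. F (p, scale_tvec s v) = s * F (p, v)) \<and>
    (\<forall>c\<in>A. continuous_on (bundle_coords c) (local_rep A c F)) \<and>
    (\<forall>c\<in>A. smooth_on (slit_coords c) (local_rep A c F)) \<and>
    (\<forall>c\<in>A. \<forall>z\<in>slit_coords c. \<forall>w. w \<noteq> 0 \<longrightarrow>
       (\<Sum>i\<in>UNIV. \<Sum>j\<in>UNIV. fund (local_rep A c F) i j z * w $ i * w $ j) > 0)"

text \<open>The continuity and smoothness of \<open>F\<close> refer to the atlas of induced charts on the tangent
  bundle. A vector field is projective if its local flow preserves oriented unparametrised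
  geodesics; as usual this is expressed infinitesimally, by the Lie derivative of the spray.\<close>

definition projective_field ::
    "'m topology \<Rightarrow> ('m, 'n::finite) chart set \<Rightarrow> ('m \<times> ('m, 'n) tvec \<Rightarrow> real)
      \<Rightarrow> ('m \<Rightarrow> ('m, 'n) tvec) \<Rightarrow> bool"
  where "projective_field M A F X \<longleftrightarrow>
    smooth_vector_field M A X \<and>
    (\<exists>\<Psi>. (\<forall>(p, v)\<in>slit_tangent_bundle M A. \<forall>s>0. \<Psi> (p, scale_tvec s v) = s * \<Psi> (p, v)) \<and>
      (\<forall>c\<in>A. \<forall>z\<in>slit_coords c. \<forall>i.
         lie_spray (field_rep c X) (spray (local_rep A c F)) i z = local_rep A c \<Psi> z * snd z $ i))"

definition I_projective_field ::
    "'m topology \<Rightarrow> ('m, 'n::finite) chart set \<Rightarrow> ('m \<times> ('m, 'n) tvec \<Rightarrow> real)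
      \<Rightarrow> ('m \<Rightarrow> ('m, 'n) tvec) \<Rightarrow> bool"
  where "I_projective_field M A F X \<longleftrightarrow>
    projective_field M A F X \<and>
    (\<forall>c\<in>A. \<forall>z\<in>slit_coords c. \<forall>i.
       lie_covector (field_rep c X) (mean_Cartan (local_rep A c F)) i z = 0)"

end

theory Submission
  imports Defs
begin

text \<open>
  Everything happens in induced coordinates \<open>(x, y)\<close> of one chart. Write \<open>G\<^sup>i\<close> for the spray
  coefficients, \<open>N\<^sup>i\<^sub>j\<close> for their \<open>y\<close>-derivatives, \<open>P = N\<^sup>m\<^sub>m\<close> for the trace, \<open>S = y\<^sup>k \<partial>/\<partial>x\<^sup>k - 2 G\<^sup>k \<partial>/\<partial>y\<^sup>k\<close>
  for the geodesic spray, \<open>E = y\<^sup>k \<partial>/\<partial>y\<^sup>k\<close> for the Euler field, \<open>X\<close> with a hat for the complete lift, and \<open>\<Psi>\<close>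
  for the projective factor; let \<open>P\<^sub>i\<^sub>j\<close> be the fibrewise Hessian of \<open>P\<close> (twice the mean Berwald curvature).

  Both Ricci tensors are differential polynomials in \<open>G\<close>. Expanding them, nearly all terms agree, and
  what remains (\<open>Ricci_difference\<close>) is \<open>-1/2\<close> times \<open>W\<^sub>i\<^sub>j = S(P\<^sub>i\<^sub>j) - N\<^sup>r\<^sub>i P\<^sub>r\<^sub>j - N\<^sup>r\<^sub>j P\<^sub>r\<^sub>i\<close>, the
  covariant derivative of the Hessian along geodesics. So it must be shown that \<open>W\<close> has Lie derivative zero.

  Being projective says that the commutator of the complete lift with \<open>S\<close> is \<open>- 2 \<Psi> E\<close>
  (\<open>bracket_Xhat_geod\<close>). Taking the \<open>y\<close>-divergence of the defining equation shows that the complete lift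
  differentiates \<open>P\<close> to \<open>(n + 1) \<Psi>\<close> up to a term linear in \<open>y\<close> (\<open>lie_spray_trace\<close>), so the Lie derivative
  of \<open>P\<^sub>i\<^sub>j\<close> is \<open>n + 1\<close> times the fibrewise Hessian of \<open>\<Psi>\<close>.

  Invariance of the mean Cartan torsion makes \<open>\<Psi>\<close> locally linear on fibres (\<open>ddy_Psi\<close>). Indeed, let \<open>\<tau>\<close> be the
  logarithm of the square root of \<open>det g\<close>. By Jacobi's formula the torsion \<open>I\<close> is the fibre differential of
  \<open>\<tau>\<close>, and \<open>P = S(\<tau>)\<close> (\<open>spray_trace_eq_dir_geod_log_volume\<close>). The Lie derivative \<open>\<phi>\<close> of \<open>\<tau>\<close>, that is, its
  derivative along the complete lift plus the divergence of \<open>X\<close>, has the Lie derivative of \<open>I\<close> as its fibre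
  differential; hence \<open>\<phi>\<close> is locally constant on fibres. Applying the commutator to \<open>P = S(\<tau>)\<close>, with \<open>E(\<tau>) = 0\<close>,
  gives \<open>(n + 1) \<Psi> = y\<^sup>k \<partial>\<phi>/\<partial>x\<^sup>k\<close>.

  Therefore \<open>P\<^sub>i\<^sub>j\<close> is invariant (\<open>lie_hess\<close>). In the Lie derivative of \<open>W\<close> (\<open>lie_hess_deriv\<close>) the commutator
  contributes \<open>- 2 \<Psi> E(P\<^sub>i\<^sub>j) = 2 \<Psi> P\<^sub>i\<^sub>j\<close>, because \<open>P\<^sub>i\<^sub>j\<close> is homogeneous of degree \<open>-1\<close>; the two connection
  terms contribute \<open>- \<Psi> P\<^sub>i\<^sub>j\<close> each, because \<open>y\<^sup>r P\<^sub>r\<^sub>j = 0\<close>. The sum is zero.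
\<close>

section \<open>Directional derivatives\<close>

definition dir :: "'a::real_normed_vector \<Rightarrow> ('a \<Rightarrow> 'b::real_normed_vector) \<Rightarrow> 'a \<Rightarrow> 'b"
  where "dir v f z = frechet_derivative f (at z) v"

lemma has_derivative_dir:
  "f differentiable (at z) \<Longrightarrow> (f has_derivative (\<lambda>v. dir v f z)) (at z)"
  unfolding dir_def by (simp add: frechet_derivative_works[symmetric] eta_contract_eq)

lemma dir_unique: "(f has_derivative f') (at z) \<Longrightarrow> dir v f z = f' v"
  unfolding dir_def using frechet_derivative_at by metis

text \<open>The Frechet derivative is chosen among the derivatives in the relational sense, and these depend only on the germ of
  the function; so the equation covers points where the derivative does not exist as well.\<close>

lemma dir_transform:
  assumes "open S" "z \<in> S" "\<And>x. x \<in> S \<Longrightarrow> f x = g x"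
  shows "dir v f z = dir v g z"
proof -
  have "(f has_derivative D) (at z) \<longleftrightarrow> (g has_derivative D) (at z)" for D
    using has_derivative_transform_within_open[of f D z UNIV S g]
      has_derivative_transform_within_open[of g D z UNIV S f] assms by auto
  then show ?thesis unfolding dir_def frechet_derivative_def by simp
qed

lemma differentiable_transform_open:
  assumes "f differentiable (at z)" "open S" "z \<in> S" "\<And>x. x \<in> S \<Longrightarrow> f x = g x"
  shows "g differentiable (at z)"
  using assms has_derivative_transform_within_open[of f _ z UNIV S g] unfolding differentiable_def by blast

section \<open>Closure properties of functions of class \<open>C\<^sup>k\<close>\<close>

lemma Ck_on_cong:
  assumes "open S" "\<And>x. x \<in> S \<Longrightarrow> f x = g x" "Ck_on k S f"
  shows "Ck_on k S g"
  using assms(2,3)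
proof (induction k arbitrary: f g)
  case 0 then show ?case using continuous_on_cong[of S S f g] by simp
next
  case (Suc k)
  have "Ck_on k S (\<lambda>x. frechet_derivative g (at x) v)" for v
  proof (rule Suc.IH)
    show "Ck_on k S (\<lambda>x. frechet_derivative f (at x) v)" using Suc.prems(2) by simp
    show "frechet_derivative f (at x) v = frechet_derivative g (at x) v" if "x \<in> S" for x
      using Suc.prems(1) by (rule dir_transform[unfolded dir_def, OF assms(1) that])
  qed
  then show ?case using Suc.prems differentiable_transform_open[of f _ S g] assms(1) by auto
qed

lemma Ck_on_Suc_imp: "Ck_on (Suc k) S f \<Longrightarrow> Ck_on k S f"
proof (induction k arbitrary: f)
  case 0
  then show ?case
    by (auto intro!: continuous_at_imp_continuous_on differentiable_imp_continuous_within)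
next
  case (Suc k)
  note D = iffD1[OF Ck_on.simps(2) Suc.prems]
  have "Ck_on k S (\<lambda>x. frechet_derivative f (at x) v)" for v
    by (rule Suc.IH) (rule D[THEN conjunct2, THEN spec])
  then show ?case using D by (intro iffD2[OF Ck_on.simps(2)]) blast
qed

lemma Ck_on_SucI:
  assumes "open S" "\<And>x. x \<in> S \<Longrightarrow> (f has_derivative f' x) (at x)"
    "\<And>v. Ck_on k S (\<lambda>x. f' x v)"
  shows "Ck_on (Suc k) S f"
proof -
  have "Ck_on k S (\<lambda>x. frechet_derivative f (at x) v)" for v
    by (rule Ck_on_cong[OF assms(1) _ assms(3)]) (simp add: frechet_derivative_at[OF assms(2), symmetric])
  then show ?thesis using assms(2) by (auto simp: differentiable_def)
qed

lemma Ck_on_D: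
  assumes "Ck_on (Suc k) S f"
  shows "x \<in> S \<Longrightarrow> (f has_derivative (\<lambda>v. dir v f x)) (at x)" "Ck_on k S (dir v f)"
  using assms has_derivative_dir unfolding dir_def[abs_def] by auto

lemma Ck_on_const: "open S \<Longrightarrow> Ck_on k S (\<lambda>x. c)"
  by (induction k arbitrary: c) (auto intro!: Ck_on_SucI[where f'="\<lambda>x v. 0"] simp del: Ck_on.simps(2))

lemma Ck_on_add:
  assumes "open S" shows "Ck_on k S f \<Longrightarrow> Ck_on k S g \<Longrightarrow> Ck_on k S (\<lambda>x. f x + g x)"
proof (induction k arbitrary: f g)
  case 0 then show ?case by (auto intro: continuous_intros)
next
  case (Suc k)
  note D = Ck_on_D[OF Suc.prems(1)] Ck_on_D[OF Suc.prems(2)]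
  show ?case
  proof (rule Ck_on_SucI[OF assms])
    show "((\<lambda>x. f x + g x) has_derivative (\<lambda>v. dir v f x + dir v g x)) (at x)" if "x \<in> S" for x
      by (rule has_derivative_add[OF D(1) D(3)]) (rule that)+
    show "Ck_on k S (\<lambda>x. dir v f x + dir v g x)" for v by (intro Suc.IH D)
  qed
qed

lemma Ck_on_mult:
  fixes f g :: "'a::real_normed_vector \<Rightarrow> real"
  assumes "open S" shows "Ck_on k S f \<Longrightarrow> Ck_on k S g \<Longrightarrow> Ck_on k S (\<lambda>x. f x * g x)"
proof (induction k arbitrary: f g)
  case 0 then show ?case by (auto intro: continuous_intros)
next
  case (Suc k)
  note D = Ck_on_D[OF Suc.prems(1)] Ck_on_D[OF Suc.prems(2)]
  note M = Ck_on_Suc_imp[OF Suc.prems(1)] Ck_on_Suc_imp[OF Suc.prems(2)]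
  show ?case
  proof (rule Ck_on_SucI[OF assms])
    show "((\<lambda>x. f x * g x) has_derivative (\<lambda>v. f x * dir v g x + dir v f x * g x)) (at x)" if "x \<in> S" for x
      by (rule has_derivative_mult[OF D(1) D(3)]) (rule that)+
    show "Ck_on k S (\<lambda>x. f x * dir v g x + dir v f x * g x)" for v
      by (intro Ck_on_add[OF assms] Suc.IH D M)
  qed
qed

lemma Ck_on_inverse:
  fixes f :: "'a::real_normed_vector \<Rightarrow> real"
  assumes "open S" and nz: "\<And>x. x \<in> S \<Longrightarrow> f x \<noteq> 0"
  shows "Ck_on k S f \<Longrightarrow> Ck_on k S (\<lambda>x. inverse (f x))"
proof (induction k)
  case 0 then show ?case using nz by (auto intro: continuous_intros)
next
  case (Suc k)
  note D = Ck_on_D[OF Suc.prems(1)]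
  have I: "Ck_on k S (\<lambda>x. inverse (f x))" using Suc.IH Ck_on_Suc_imp[OF Suc.prems(1)] by simp
  show ?case
  proof (rule Ck_on_SucI[OF assms(1)])
    show "((\<lambda>x. inverse (f x)) has_derivative (\<lambda>v. - (inverse (f x) * dir v f x * inverse (f x)))) (at x)"
      if "x \<in> S" for x using D(1)[OF that] nz[OF that] by (rule Deriv.has_derivative_inverse[rotated])
    show "Ck_on k S (\<lambda>x. - (inverse (f x) * dir v f x * inverse (f x)))" for v
      using Ck_on_mult[OF assms(1) Ck_on_const[OF assms(1), of k "- 1"]
          Ck_on_mult[OF assms(1) Ck_on_mult[OF assms(1) I D(2)] I]] by simp
  qed
qed

text \<open>The derivative \<open>f'\<close> divided by \<open>f\<close> is one class lower and needs only the closure under products and inverses, so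
  a case distinction replaces an induction.\<close>

lemma Ck_on_ln:
  fixes f :: "'a::real_normed_vector \<Rightarrow> real"
  assumes "open S" and pos: "\<And>x. x \<in> S \<Longrightarrow> f x > 0" and f: "Ck_on k S f"
  shows "Ck_on k S (\<lambda>x. ln (f x))"
proof (cases k)
  case 0
  have "continuous_on S f" using f unfolding 0 by simp
  then have "continuous_on S (\<lambda>x. ln (f x))"
    by (rule continuous_on_ln) (use pos in force)
  then show ?thesis unfolding 0 by simp
next
  case (Suc k')
  note f' = f[unfolded Suc]
  note D = Ck_on_D[OF f']
  have I: "Ck_on k' S (\<lambda>x. inverse (f x))"
    by (rule Ck_on_inverse[OF assms(1) _ Ck_on_Suc_imp[OF f']]) (use pos in force)
  show ?thesis unfolding Suc
  proof (rule Ck_on_SucI[OF assms(1)])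
    show "((\<lambda>x. ln (f x)) has_derivative (\<lambda>v. dir v f x * inverse (f x))) (at x)" if "x \<in> S" for x
      by (rule has_derivative_ln[OF pos[OF that] D(1)[OF that]])
    show "Ck_on k' S (\<lambda>x. dir v f x * inverse (f x))" for v
      by (rule Ck_on_mult[OF assms(1) D(2) I])
  qed
qed

section \<open>Smooth functions on open sets\<close>

lemma smooth_on_imp_Ck: "smooth_on S f \<Longrightarrow> Ck_on k S f"
  unfolding smooth_on_def by blast

lemma smooth_on_differentiable: "smooth_on S f \<Longrightarrow> z \<in> S \<Longrightarrow> f differentiable (at z)"
  using smooth_on_imp_Ck[of S f "Suc 0"] unfolding Ck_on.simps by blast

lemma smooth_on_cong: "open S \<Longrightarrow> (\<And>x. x \<in> S \<Longrightarrow> f x = g x) \<Longrightarrow> smooth_on S f \<Longrightarrow> smooth_on S g"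
  unfolding smooth_on_def by (intro allI, rule Ck_on_cong[of S f]) auto

lemma smooth_on_dir: "smooth_on S f \<Longrightarrow> smooth_on S (dir v f)"
  unfolding smooth_on_def by (auto intro: Ck_on_D(2) simp del: Ck_on.simps)

lemma smooth_on_const: "open S \<Longrightarrow> smooth_on S (\<lambda>x. c)"
  unfolding smooth_on_def by (auto intro: Ck_on_const)

lemma smooth_on_add: "open S \<Longrightarrow> smooth_on S f \<Longrightarrow> smooth_on S g \<Longrightarrow> smooth_on S (\<lambda>x. f x + g x)"
  unfolding smooth_on_def by (auto intro: Ck_on_add)

lemma smooth_on_mult:
  fixes f g :: "'a::real_normed_vector \<Rightarrow> real"
  shows "open S \<Longrightarrow> smooth_on S f \<Longrightarrow> smooth_on S g \<Longrightarrow> smooth_on S (\<lambda>x. f x * g x)"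
  unfolding smooth_on_def by (auto intro: Ck_on_mult)

lemma smooth_on_diff:
  fixes f g :: "'a::real_normed_vector \<Rightarrow> real"
  shows "open S \<Longrightarrow> smooth_on S f \<Longrightarrow> smooth_on S g \<Longrightarrow> smooth_on S (\<lambda>x. f x - g x)"
  using smooth_on_add[of S f "\<lambda>x. (- 1) * g x"] smooth_on_mult[of S "\<lambda>x. - 1" g] smooth_on_const[of S "- 1 :: real"] by simp

lemma smooth_on_sum:
  assumes "open S" "\<And>i. i \<in> I \<Longrightarrow> smooth_on S (f i)"
  shows "smooth_on S (\<lambda>x. \<Sum>i\<in>I. f i x)"
  using assms(2)
  by (induction I rule: infinite_finite_induct) (auto intro: smooth_on_add smooth_on_const assms(1))

lemma smooth_on_prod:
  fixes f :: "'i \<Rightarrow> 'a::real_normed_vector \<Rightarrow> real"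
  assumes "open S" "\<And>i. i \<in> I \<Longrightarrow> smooth_on S (f i)"
  shows "smooth_on S (\<lambda>x. \<Prod>i\<in>I. f i x)"
  using assms(2)
  by (induction I rule: infinite_finite_induct) (auto intro: smooth_on_mult smooth_on_const assms(1))

lemma smooth_on_divide:
  fixes f :: "'a::real_normed_vector \<Rightarrow> real"
  assumes "open S" "smooth_on S f" "smooth_on S g" "\<And>x. x \<in> S \<Longrightarrow> g x \<noteq> 0"
  shows "smooth_on S (\<lambda>x. f x / g x)"
proof -
  have "smooth_on S (\<lambda>x. inverse (g x))"
    unfolding smooth_on_def using assms by (intro allI Ck_on_inverse smooth_on_imp_Ck) auto
  then show ?thesis unfolding divide_inverse by (intro smooth_on_mult assms(1,2))
qed

lemma smooth_on_ln:
  fixes f :: "'a::real_normed_vector \<Rightarrow> real"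
  assumes "open S" "smooth_on S f" "\<And>x. x \<in> S \<Longrightarrow> f x > 0"
  shows "smooth_on S (\<lambda>x. ln (f x))"
  unfolding smooth_on_def using assms by (intro allI Ck_on_ln smooth_on_imp_Ck) auto

lemma smooth_on_linear:
  assumes "open S" "bounded_linear L" "smooth_on S f"
  shows "smooth_on S (\<lambda>x. L (f x))"
proof -
  have "Ck_on k S (\<lambda>x. L (f x))" for k
    using smooth_on_imp_Ck[OF assms(3), of k]
  proof (induction k arbitrary: f)
    case 0 then show ?case using bounded_linear.continuous_on[OF assms(2)] by auto
  next
    case (Suc k)
    note D = Ck_on_D[OF Suc.prems(1)]
    show ?case
    proof (rule Ck_on_SucI[OF assms(1)])
      show "((\<lambda>x. L (f x)) has_derivative (\<lambda>v. L (dir v f x))) (at x)" if "x \<in> S" for x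
        by (rule bounded_linear.has_derivative[OF assms(2) D(1)[OF that]])
      show "Ck_on k S (\<lambda>x. L (dir v f x))" for v by (intro Suc.IH D)
    qed
  qed
  then show ?thesis by (simp add: smooth_on_def)
qed

lemma smooth_on_minus: "open S \<Longrightarrow> smooth_on S f \<Longrightarrow> smooth_on S (\<lambda>x. - f x)"
  by (rule smooth_on_linear[OF _ bounded_linear_minus[OF bounded_linear_ident]])

lemma smooth_on_divide_const:
  fixes f :: "'a::real_normed_vector \<Rightarrow> real"
  shows "open S \<Longrightarrow> smooth_on S f \<Longrightarrow> smooth_on S (\<lambda>x. f x / c)"
  by (rule smooth_on_linear[OF _ bounded_linear_divide])

lemma smooth_on_ident: "open S \<Longrightarrow> smooth_on S (\<lambda>x. x)"
  unfolding smooth_on_def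
proof
  fix k assume S: "open S"
  show "Ck_on k S (\<lambda>x. x)"
  proof (cases k)
    case (Suc k') then show ?thesis
      by (simp only: Suc) (rule Ck_on_SucI[OF S has_derivative_ident Ck_on_const[OF S]])
  qed auto
qed

lemma dir_compose_fst:
  assumes "h differentiable (at (fst z))"
  shows "dir v (\<lambda>z. h (fst z)) z = dir (fst v) h (fst z)"
  and "(\<lambda>z. h (fst z)) differentiable (at z)"
proof -
  have "((\<lambda>z. h (fst z)) has_derivative (\<lambda>v. dir (fst v) h (fst z))) (at z)"
    using diff_chain_at[OF bounded_linear_imp_has_derivative[OF bounded_linear_fst] has_derivative_dir[OF assms]]
    by (simp add: o_def)
  then show "dir v (\<lambda>z. h (fst z)) z = dir (fst v) h (fst z)" "(\<lambda>z. h (fst z)) differentiable (at z)"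
    using dir_unique by (auto simp: differentiable_def)
qed

text \<open>A function of the base point alone: its derivative in direction \<open>v\<close> is the derivative of \<open>h\<close> in direction
  \<open>fst v\<close>, again a function of the base point, so an induction over the class goes through.\<close>

lemma smooth_on_compose_fst:
  assumes "open S" "S \<subseteq> U \<times> UNIV" "smooth_on U h"
  shows "smooth_on S (\<lambda>z. h (fst z))"
proof -
  have "Ck_on k S (\<lambda>z. h (fst z))" for k
    using smooth_on_imp_Ck[OF assms(3), of k]
  proof (induction k arbitrary: h)
    case 0 then show ?case using assms(2)
      by (auto intro!: continuous_on_compose2[OF _ continuous_on_fst[OF continuous_on_id]])
  next
    case (Suc k)
    have fU: "fst z \<in> U" if "z \<in> S" for z using assms(2) that by auto
    have dh: "h differentiable (at (fst z))" if "z \<in> S" for z using Suc.prems fU[OF that] by simp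
    note D = Ck_on_D[OF Suc.prems(1)]
    show ?case
    proof (rule Ck_on_SucI[OF assms(1)])
      show "((\<lambda>z. h (fst z)) has_derivative (\<lambda>v. dir (fst v) h (fst z))) (at z)" if "z \<in> S" for z
        using has_derivative_dir[OF dir_compose_fst(2)[OF dh[OF that]]]
        by (simp add: dir_compose_fst(1)[OF dh[OF that]])
      show "Ck_on k S (\<lambda>z. dir (fst v) h (fst z))" for v by (rule Suc.IH) (rule D)
    qed
  qed
  then show ?thesis by (simp add: smooth_on_def)
qed

section \<open>Calculation rules for directional derivatives\<close>

lemma dir_const [simp]: "dir v (\<lambda>x. c) z = 0" by (simp add: dir_def)

lemma dir_add: "f differentiable (at z) \<Longrightarrow> g differentiable (at z) \<Longrightarrow>
    dir v (\<lambda>x. f x + g x) z = dir v f z + dir v g z"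
  using dir_unique[OF has_derivative_add[OF has_derivative_dir has_derivative_dir]] by blast

lemma dir_diff: "f differentiable (at z) \<Longrightarrow> g differentiable (at z) \<Longrightarrow>
    dir v (\<lambda>x. f x - g x) z = dir v f z - dir v g z"
  using dir_unique[OF has_derivative_diff[OF has_derivative_dir has_derivative_dir]] by blast

lemma dir_mult:
  fixes f g :: "'a::real_normed_vector \<Rightarrow> real"
  shows "f differentiable (at z) \<Longrightarrow> g differentiable (at z) \<Longrightarrow>
    dir v (\<lambda>x. f x * g x) z = dir v f z * g z + f z * dir v g z"
  using dir_unique[OF has_derivative_mult[OF has_derivative_dir has_derivative_dir]] by (simp add: add.commute)

lemma dir_sum: "(\<And>i. i \<in> I \<Longrightarrow> f i differentiable (at z)) \<Longrightarrow>
    dir v (\<lambda>x. \<Sum>i\<in>I. f i x) z = (\<Sum>i\<in>I. dir v (f i) z)"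
  using dir_unique[OF has_derivative_sum[of I f, OF has_derivative_dir]] by blast

lemma dir_linear: "bounded_linear L \<Longrightarrow> f differentiable (at z) \<Longrightarrow>
    dir v (\<lambda>x. L (f x)) z = L (dir v f z)"
  using dir_unique[OF bounded_linear.has_derivative[OF _ has_derivative_dir]] by blast

lemma dir_minus: "f differentiable (at z) \<Longrightarrow> dir v (\<lambda>x. - f x) z = - dir v f z"
  by (rule dir_linear[OF bounded_linear_minus[OF bounded_linear_ident]])

lemma dir_divide_const:
  fixes f :: "'a::real_normed_vector \<Rightarrow> real"
  shows "f differentiable (at z) \<Longrightarrow> dir v (\<lambda>x. f x / c) z = dir v f z / c"
  by (rule dir_linear[OF bounded_linear_divide])

lemma linear_dir: "f differentiable (at z) \<Longrightarrow> linear (\<lambda>v. dir v f z)"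
  unfolding dir_def by (simp add: linear_frechet_derivative eta_contract_eq)

section \<open>Symmetry of second derivatives\<close>

lemma has_real_derivative_along_line:
  fixes f :: "'a::real_normed_vector \<Rightarrow> real"
  assumes "f differentiable (at (p + s *\<^sub>R v))"
  shows "((\<lambda>s. f (p + s *\<^sub>R v)) has_real_derivative dir v f (p + s *\<^sub>R v)) (at s)"
proof -
  have L: "((\<lambda>s. p + s *\<^sub>R v) has_derivative (\<lambda>h. h *\<^sub>R v)) (at s)"
    by (auto intro!: derivative_eq_intros)
  have "((\<lambda>s. f (p + s *\<^sub>R v)) has_derivative (\<lambda>h. dir (h *\<^sub>R v) f (p + s *\<^sub>R v))) (at s)"
    using diff_chain_at[OF L has_derivative_dir[OF assms]] by (simp add: o_def)
  moreover have "dir (h *\<^sub>R v) f (p + s *\<^sub>R v) = dir v f (p + s *\<^sub>R v) * h" for h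
    using linear_cmul[OF linear_dir[OF assms]] by simp
  ultimately show ?thesis
    unfolding has_field_derivative_def by (rule has_derivative_eq_rhs[OF _ ext])
qed

text \<open>The second difference is symmetric in \<open>v\<close> and \<open>w\<close>, whereas the limit singles out an order of
  differentiation; this is how Schwarz's theorem follows. The mean value theorem is applied once in each direction,
  which turns the second difference into \<open>h\<^sup>2\<close> times a second derivative at a nearby point.\<close>

lemma second_difference_quotient:
  fixes f :: "'a::real_normed_vector \<Rightarrow> real"
  assumes "open S" "z \<in> S" "Ck_on 2 S f"
  shows "((\<lambda>h. (f (z + h *\<^sub>R v + h *\<^sub>R w) - f (z + h *\<^sub>R v) - f (z + h *\<^sub>R w) + f z) / h\<^sup>2)
     \<longlongrightarrow> dir w (dir v f) z) (at_right 0)"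
proof -
  have C: "Ck_on (Suc (Suc 0)) S f" using assms(3) by (simp only: numeral_2_eq_2)
  have df: "f differentiable (at x)" if "x \<in> S" for x using C that by simp
  have ddf: "dir v f differentiable (at x)" if "x \<in> S" for x using C that unfolding dir_def[abs_def] by simp
  have cont: "continuous_on S (dir w (dir v f))" using C unfolding dir_def[abs_def] by simp
  obtain r where r: "r > 0" "ball z r \<subseteq> S" using assms(1,2) openE by blast
  define m where "m = norm v + norm w + 1"
  have m: "m > 0" unfolding m_def by (simp add: add_nonneg_pos)
  have inb: "dist (z + s *\<^sub>R v + t *\<^sub>R w) z < e" if "0 \<le> s" "s \<le> h" "0 \<le> t" "t \<le> h" "0 < h" "h < e / m" for s t h e
  proof -
    have "dist (z + s *\<^sub>R v + t *\<^sub>R w) z = norm (s *\<^sub>R v + t *\<^sub>R w)" by (simp add: dist_norm algebra_simps)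
    also have "\<dots> \<le> s * norm v + t * norm w" using norm_triangle_ineq[of "s *\<^sub>R v" "t *\<^sub>R w"] that by simp
    also have "\<dots> \<le> h * norm v + h * norm w" using that by (intro add_mono mult_right_mono) auto
    also have "\<dots> < h * m" using that by (simp add: m_def algebra_simps)
    also have "\<dots> < e" using that m by (simp add: pos_less_divide_eq)
    finally show ?thesis .
  qed
  have inS: "z + s *\<^sub>R v + t *\<^sub>R w \<in> S" if "0 \<le> s" "s \<le> h" "0 \<le> t" "t \<le> h" "0 < h" "h < r / m" for s t h
    using inb[OF that] r(2) by (auto simp: dist_commute)
  have ex: "\<exists>s t. 0 < s \<and> s < h \<and> 0 < t \<and> t < h \<and>
     f (z + h *\<^sub>R v + h *\<^sub>R w) - f (z + h *\<^sub>R v) - f (z + h *\<^sub>R w) + f z = h\<^sup>2 * dir w (dir v f) (z + s *\<^sub>R v + t *\<^sub>R w)"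
    if h: "0 < h" "h < r / m" for h
  proof -
    let ?p = "\<lambda>s. f ((z + h *\<^sub>R w) + s *\<^sub>R v) - f (z + s *\<^sub>R v)"
    have "\<exists>s>0. s < h \<and> ?p h - ?p 0 = (h - 0) * (dir v f ((z + h *\<^sub>R w) + s *\<^sub>R v) - dir v f (z + s *\<^sub>R v))"
    proof (rule MVT2[OF h(1)])
      fix s assume s: "0 \<le> s" "s \<le> h"
      have "z + s *\<^sub>R v + h *\<^sub>R w \<in> S" "z + s *\<^sub>R v + 0 *\<^sub>R w \<in> S" using inS[OF s, of h] inS[OF s, of 0] h by auto
      then have "f differentiable (at ((z + h *\<^sub>R w) + s *\<^sub>R v))" "f differentiable (at (z + s *\<^sub>R v))"
        using df by (auto simp: algebra_simps)
      then show "(?p has_real_derivative dir v f ((z + h *\<^sub>R w) + s *\<^sub>R v) - dir v f (z + s *\<^sub>R v)) (at s)"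
        by (intro DERIV_diff has_real_derivative_along_line)
    qed
    then obtain s where s: "0 < s" "s < h"
      "?p h - ?p 0 = h * (dir v f ((z + h *\<^sub>R w) + s *\<^sub>R v) - dir v f (z + s *\<^sub>R v))" by auto
    let ?q = "\<lambda>t. dir v f ((z + s *\<^sub>R v) + t *\<^sub>R w)"
    have "\<exists>t>0. t < h \<and> ?q h - ?q 0 = (h - 0) * dir w (dir v f) ((z + s *\<^sub>R v) + t *\<^sub>R w)"
    proof (rule MVT2[OF h(1)])
      fix t assume t: "0 \<le> t" "t \<le> h"
      have "z + s *\<^sub>R v + t *\<^sub>R w \<in> S" using inS[OF _ _ t h] s by auto
      then show "(?q has_real_derivative dir w (dir v f) ((z + s *\<^sub>R v) + t *\<^sub>R w)) (at t)"
        using ddf by (intro has_real_derivative_along_line) auto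
    qed
    then obtain t where t: "0 < t" "t < h" "?q h - ?q 0 = h * dir w (dir v f) ((z + s *\<^sub>R v) + t *\<^sub>R w)" by auto
    have "?p h - ?p 0 = h * (?q h - ?q 0)" using s(3) by (simp add: algebra_simps)
    also have "\<dots> = h\<^sup>2 * dir w (dir v f) (z + s *\<^sub>R v + t *\<^sub>R w)" using t(3) by (simp add: power2_eq_square)
    finally have "?p h - ?p 0 = h\<^sup>2 * dir w (dir v f) (z + s *\<^sub>R v + t *\<^sub>R w)" .
    then show ?thesis using s t by (intro exI[of _ s] exI[of _ t]) (simp add: algebra_simps)
  qed
  show ?thesis
  proof (rule tendstoI)
    fix e :: real assume "e > 0"
    have "isCont (dir w (dir v f)) z" using cont assms(1,2) continuous_on_eq_continuous_at by blast
    then obtain d where d: "d > 0" "\<And>x. dist x z < d \<Longrightarrow> dist (dir w (dir v f) x) (dir w (dir v f) z) < e"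
      using \<open>e > 0\<close> unfolding continuous_at_eps_delta by (metis dist_commute)
    show "\<forall>\<^sub>F h in at_right 0. dist ((f (z + h *\<^sub>R v + h *\<^sub>R w) - f (z + h *\<^sub>R v) - f (z + h *\<^sub>R w) + f z) / h\<^sup>2)
       (dir w (dir v f) z) < e"
      unfolding eventually_at_right_field
    proof (intro exI[of _ "min (r/m) (d/m)"] conjI allI impI)
      show "min (r/m) (d/m) > 0" using r d m by simp
      fix h :: real assume h: "0 < h" "h < min (r/m) (d/m)"
      obtain s t where st: "0 < s" "s < h" "0 < t" "t < h"
        "f (z + h *\<^sub>R v + h *\<^sub>R w) - f (z + h *\<^sub>R v) - f (z + h *\<^sub>R w) + f z = h\<^sup>2 * dir w (dir v f) (z + s *\<^sub>R v + t *\<^sub>R w)"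
        using ex[of h] h by auto
      have "dist (z + s *\<^sub>R v + t *\<^sub>R w) z < d" using inb[of s h t d] st h by auto
      then show "dist ((f (z + h *\<^sub>R v + h *\<^sub>R w) - f (z + h *\<^sub>R v) - f (z + h *\<^sub>R w) + f z) / h\<^sup>2)
       (dir w (dir v f) z) < e" using d(2) st(5) h by simp
    qed
  qed
qed

lemma dir_commute:
  fixes f :: "'a::real_normed_vector \<Rightarrow> real"
  assumes "open S" "smooth_on S f" "z \<in> S"
  shows "dir v (dir w f) z = dir w (dir v f) z"
proof (rule tendsto_unique[OF trivial_limit_at_right_real])
  note q = second_difference_quotient[OF assms(1,3) smooth_on_imp_Ck[OF assms(2)]]
  show "((\<lambda>h. (f (z + h *\<^sub>R v + h *\<^sub>R w) - f (z + h *\<^sub>R v) - f (z + h *\<^sub>R w) + f z) / h\<^sup>2)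
     \<longlongrightarrow> dir w (dir v f) z) (at_right 0)" by (rule q)
  show "((\<lambda>h. (f (z + h *\<^sub>R v + h *\<^sub>R w) - f (z + h *\<^sub>R v) - f (z + h *\<^sub>R w) + f z) / h\<^sup>2)
     \<longlongrightarrow> dir v (dir w f) z) (at_right 0)" using q[of w v] by (simp add: algebra_simps)
qed

section \<open>Commutators of vector fields\<close>

text \<open>The product rule for \<open>df(W)\<close>, obtained by expanding \<open>W\<close> in an orthonormal basis.\<close>

lemma dir_along:
  fixes f :: "'a::euclidean_space \<Rightarrow> real"
  assumes "open S" "smooth_on S f" "z \<in> S" "W differentiable (at z)"
  shows "dir v (\<lambda>x. dir (W x) f x) z = dir v (dir (W z) f) z + dir (dir v W z) f z"
    and "(\<lambda>x. dir (W x) f x) differentiable (at z)"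
proof -
  have lin: "dir w f x = (\<Sum>b\<in>Basis. (w \<bullet> b) * dir b f x)" if "x \<in> S" for w x
    using linear_sum[OF linear_dir[OF smooth_on_differentiable[OF assms(2) that]], of "\<lambda>b. (w \<bullet> b) *\<^sub>R b" Basis]
    by (simp add: euclidean_representation linear_cmul[OF linear_dir[OF smooth_on_differentiable[OF assms(2) that]]])
  have sd: "dir b f differentiable (at z)" for b using smooth_on_differentiable[OF smooth_on_dir[OF assms(2)] assms(3)] .
  have Wb: "(\<lambda>x. W x \<bullet> b) differentiable (at z)" for b using assms(4) by (simp add: differentiable_inner)
  have dW: "dir v (\<lambda>x. W x \<bullet> b) z = dir v W z \<bullet> b" for b
    by (rule dir_linear[OF bounded_linear_inner_left assms(4)])
  have pd: "(\<lambda>x. (W x \<bullet> b) * dir b f x) differentiable (at z)" for b using Wb sd by (intro differentiable_mult)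
  have "dir v (\<lambda>x. dir (W x) f x) z = dir v (\<lambda>x. \<Sum>b\<in>Basis. (W x \<bullet> b) * dir b f x) z"
    by (rule dir_transform[OF assms(1,3)]) (rule lin)
  also have "\<dots> = (\<Sum>b\<in>Basis. (dir v W z \<bullet> b) * dir b f z + (W z \<bullet> b) * dir v (dir b f) z)"
    by (simp add: dir_sum pd dir_mult Wb sd dW)
  also have "\<dots> = dir (dir v W z) f z + (\<Sum>b\<in>Basis. (W z \<bullet> b) * dir v (dir b f) z)"
    by (simp add: sum.distrib lin[OF assms(3), of "dir v W z"])
  also have "(\<Sum>b\<in>Basis. (W z \<bullet> b) * dir v (dir b f) z) = dir v (\<lambda>x. \<Sum>b\<in>Basis. (W z \<bullet> b) * dir b f x) z"
    by (simp add: dir_sum dir_mult sd differentiable_mult)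
  also have "\<dots> = dir v (dir (W z) f) z"
    by (rule dir_transform[OF assms(1,3)]) (rule lin[symmetric])
  finally show "dir v (\<lambda>x. dir (W x) f x) z = dir v (dir (W z) f) z + dir (dir v W z) f z" by simp
  have "(\<lambda>x. \<Sum>b\<in>Basis. (W x \<bullet> b) * dir b f x) differentiable (at z)" using pd by (intro differentiable_sum) auto
  then show "(\<lambda>x. dir (W x) f x) differentiable (at z)"
    by (rule differentiable_transform_open[OF _ assms(1,3)]) (rule lin[symmetric])
qed

text \<open>Second derivatives of \<open>f\<close> cancel by symmetry, and what is left is \<open>df\<close> of the Lie bracket. All commutation rules
  for the complete lift rest on this.\<close>

lemma vector_field_bracket:
  fixes f :: "'a::euclidean_space \<Rightarrow> real"
  assumes "open S" "smooth_on S f" "z \<in> S" "V differentiable (at z)" "W differentiable (at z)"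
  shows "dir (V z) (\<lambda>x. dir (W x) f x) z - dir (W z) (\<lambda>x. dir (V x) f x) z
       = dir (dir (V z) W z - dir (W z) V z) f z"
  using dir_along(1)[OF assms(1-3,5), of "V z"] dir_along(1)[OF assms(1-3,4), of "W z"]
    dir_commute[OF assms(1-3), of "V z" "W z"]
    linear_diff[OF linear_dir[OF smooth_on_differentiable[OF assms(2,3)]], of "dir (V z) W z" "dir (W z) V z"]
  by simp

section \<open>Determinants and inverses of smooth matrix functions\<close>

lemma smooth_on_det:
  fixes a :: "'n::finite \<Rightarrow> 'n \<Rightarrow> 'a::real_normed_vector \<Rightarrow> real"
  assumes "open S" "\<And>i j. smooth_on S (a i j)"
  shows "smooth_on S (\<lambda>z. det (\<chi> i j. a i j z))"
  unfolding det_def vec_lambda_beta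
  by (intro smooth_on_sum smooth_on_mult smooth_on_const smooth_on_prod assms)

lemma matrix_inv_mult:
  fixes A :: "real^'n^'n"
  assumes "det A \<noteq> 0"
  shows "A ** matrix_inv A = mat 1" "matrix_inv A ** A = mat 1"
proof -
  have "\<exists>A'. A ** A' = mat 1 \<and> A' ** A = mat 1" using assms invertible_det_nz[of A] unfolding invertible_def by blast
  from someI_ex[OF this] show "A ** matrix_inv A = mat 1" "matrix_inv A ** A = mat 1"
    unfolding matrix_inv_def by blast+
qed

text \<open>Cramer's rule exhibits the entries of the inverse as rational functions of the entries of the matrix; this is
  what makes the inverse of a smooth matrix function smooth.\<close>

lemma matrix_inv_cofactor:
  fixes A :: "real^'n^'n"
  assumes "det A \<noteq> 0"
  shows "matrix_inv A $ i $ j = det (\<chi> r c. if c = i then axis j 1 $ r else A $ r $ c) / det A"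
proof -
  have "A *v (matrix_inv A *v axis j 1) = axis j 1"
    by (simp add: matrix_vector_mul_assoc matrix_inv_mult[OF assms])
  then have "matrix_inv A *v axis j 1 = (\<chi> k. det (\<chi> r c. if c = k then axis j 1 $ r else A $ r $ c) / det A)"
    using cramer[OF assms] by blast
  then have "(matrix_inv A *v axis j 1) $ i = det (\<chi> r c. if c = i then axis j 1 $ r else A $ r $ c) / det A"
    by simp
  then show ?thesis by (simp add: matrix_vector_mul_component inner_axis)
qed

lemma smooth_on_matrix_inv:
  fixes a :: "'n::finite \<Rightarrow> 'n \<Rightarrow> 'a::real_normed_vector \<Rightarrow> real"
  assumes "open S" "\<And>i j. smooth_on S (a i j)" "\<And>z. z \<in> S \<Longrightarrow> det (\<chi> i j. a i j z) \<noteq> 0"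
  shows "smooth_on S (\<lambda>z. matrix_inv (\<chi> i j. a i j z) $ k $ l)"
proof (rule smooth_on_cong[OF assms(1)])
  show "smooth_on S (\<lambda>z. det (\<chi> r c. if c = k then axis l 1 $ r else a r c z) / det (\<chi> i j. a i j z))"
  proof (intro smooth_on_divide smooth_on_det assms)
    show "smooth_on S (\<lambda>z. if c = k then axis l 1 $ r else a r c z)" for r c
      using assms(2) smooth_on_const[OF assms(1)] by (cases "c = k") auto
  qed
  show "det (\<chi> r c. if c = k then axis l 1 $ r else a r c z) / det (\<chi> i j. a i j z)
      = matrix_inv (\<chi> i j. a i j z) $ k $ l" if "z \<in> S" for z
    using matrix_inv_cofactor[OF assms(3)[OF that], of k l] by (simp cong: if_cong)
qed

text \<open>A permutation other than the identity moves at least two points, so after dropping one factor an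
  off-diagonal entry of the identity matrix remains.\<close>

lemma permutes_prod_eq_0:
  fixes C :: "'n::finite \<Rightarrow> 'n \<Rightarrow> real"
  assumes "p permutes UNIV" "p \<noteq> id" "\<And>i j. C i j = (if i = j then 1 else 0)"
  shows "(\<Prod>j\<in>UNIV - {i}. C j (p j)) = 0"
proof -
  obtain k where k: "p k \<noteq> k" using assms(2) by (metis eq_id_iff)
  have inj: "inj p" using permutes_inj assms(1) by blast
  have "\<exists>j. j \<noteq> i \<and> p j \<noteq> j"
  proof (cases "k = i")
    case True
    then have "p (p k) \<noteq> p k" using k inj by (metis injD)
    then show ?thesis using k True by metis
  qed (use k in blast)
  then obtain j where "j \<noteq> i" "p j \<noteq> j" by blast
  then show ?thesis using assms(3)[of j "p j"] by (intro prod_zero) auto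
qed

lemma has_derivative_det:
  fixes a :: "'n::finite \<Rightarrow> 'n \<Rightarrow> 'a::real_normed_vector \<Rightarrow> real"
  assumes "\<And>i j. a i j differentiable (at z)"
  shows "((\<lambda>x. det (\<chi> i j. a i j x)) has_derivative (\<lambda>v. \<Sum>p\<in>{p. p permutes UNIV}. of_int (sign p) *
    (\<Sum>i\<in>UNIV. dir v (a i (p i)) z * (\<Prod>j\<in>UNIV-{i}. a j (p j) z)))) (at z)"
  unfolding det_def vec_lambda_beta
  by (intro has_derivative_sum has_derivative_mult_right has_derivative_prod has_derivative_dir assms)

lemma differentiable_det:
  fixes a :: "'n::finite \<Rightarrow> 'n \<Rightarrow> 'a::real_normed_vector \<Rightarrow> real"
  assumes "\<And>i j. a i j differentiable (at z)"
  shows "(\<lambda>x. det (\<chi> i j. a i j x)) differentiable (at z)"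
  unfolding differentiable_def by (rule exI, rule has_derivative_det[of a z, OF assms])

lemma dir_det_at_identity:
  fixes c :: "'n::finite \<Rightarrow> 'n \<Rightarrow> 'a::real_normed_vector \<Rightarrow> real"
  assumes "\<And>i j. c i j differentiable (at z)" "\<And>i j. c i j z = (if i = j then 1 else 0)"
  shows "dir v (\<lambda>x. det (\<chi> i j. c i j x)) z = (\<Sum>i\<in>UNIV. dir v (c i i) z)"
proof -
  let ?D = "\<lambda>p v. \<Sum>i\<in>UNIV. dir v (c i (p i)) z * (\<Prod>j\<in>UNIV-{i}. c j (p j) z)"
  have "dir v (\<lambda>x. det (\<chi> i j. c i j x)) z = (\<Sum>p\<in>{p. p permutes UNIV}. of_int (sign p) * ?D p v)"
    by (rule dir_unique[OF has_derivative_det[OF assms(1)]])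
  also have "\<dots> = (\<Sum>p\<in>{id}. of_int (sign p) * ?D p v)"
  proof (rule sum.mono_neutral_right)
    show "\<forall>p\<in>{p. p permutes UNIV} - {id}. of_int (sign p) * ?D p v = 0"
    proof
      fix p :: "'n \<Rightarrow> 'n" assume "p \<in> {p. p permutes UNIV} - {id}"
      then have "(\<Prod>j\<in>UNIV - {i}. c j (p j) z) = 0" for i
        by (intro permutes_prod_eq_0[of p "\<lambda>i j. c i j z"] assms(2)) auto
      then show "of_int (sign p) * ?D p v = 0" by (simp only: mult_zero_right sum.neutral_const)
    qed
  qed (auto simp: permutes_id)
  also have "\<dots> = (\<Sum>i\<in>UNIV. dir v (c i i) z)" by (simp add: sign_id assms(2))
  finally show ?thesis .
qed

text \<open>Jacobi's formula. Multiplying by the inverse at \<open>z\<close> reduces it to a matrix function that is the identity at \<open>z\<close>, where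
  only the diagonal term of the Leibniz expansion contributes to first order.\<close>

lemma dir_det:
  fixes a :: "'n::finite \<Rightarrow> 'n \<Rightarrow> 'a::real_normed_vector \<Rightarrow> real"
  assumes d: "\<And>i j. a i j differentiable (at z)" and nz: "det (\<chi> i j. a i j z) \<noteq> 0"
  shows "dir v (\<lambda>x. det (\<chi> i j. a i j x)) z = det (\<chi> i j. a i j z) *
    (\<Sum>j\<in>UNIV. \<Sum>k\<in>UNIV. matrix_inv (\<chi> i j. a i j z) $ j $ k * dir v (a k j) z)"
proof -
  let ?A = "\<lambda>x. \<chi> i j. a i j x"
  define B where "B = matrix_inv (?A z)"
  define c where "c = (\<lambda>i j x. \<Sum>k\<in>UNIV. B $ i $ k * a k j x)"
  have C: "(\<chi> i j. c i j x) = B ** ?A x" for x by (simp add: c_def matrix_matrix_mult_def)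
  have BA: "B ** ?A z = mat 1" unfolding B_def using matrix_inv_mult[OF nz] by simp
  have "c i j z = (B ** ?A z) $ i $ j" for i j by (simp only: C[symmetric] vec_lambda_beta)
  then have cz: "c i j z = (if i = j then 1 else 0)" for i j by (simp only: BA) (simp add: mat_def)
  have ad: "(\<lambda>x. B $ i $ k * a k j x) differentiable (at z)" for i k j by (simp add: d)
  have cd: "c i j differentiable (at z)" for i j
    unfolding c_def by (intro differentiable_sum ballI ad) simp
  have dc: "dir v (c i j) z = (\<Sum>k\<in>UNIV. B $ i $ k * dir v (a k j) z)" for i j
    unfolding c_def by (simp add: dir_sum ad dir_mult d)
  \<comment> \<open>Factor \<open>A(x)\<close> as \<open>A(z)\<close> times \<open>c(x) = B A(x)\<close>, which is the identity at \<open>z\<close>.\<close>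
  have "det B * det (?A z) = 1" using BA by (metis det_I det_mul)
  then have "det (?A x) = det (?A z) * det (\<chi> i j. c i j x)" for x
    unfolding C det_mul by algebra
  then have "dir v (\<lambda>x. det (?A x)) z = dir v (\<lambda>x. det (?A z) * det (\<chi> i j. c i j x)) z"
    by (intro arg_cong[where f="\<lambda>f. dir v f z"] ext)
  also have "\<dots> = det (?A z) * dir v (\<lambda>x. det (\<chi> i j. c i j x)) z"
  proof (rule dir_linear[OF bounded_linear_mult_right])
    show "(\<lambda>x. det (\<chi> i j. c i j x)) differentiable (at z)" by (rule differentiable_det[OF cd])
  qed
  also have "\<dots> = det (?A z) * (\<Sum>i\<in>UNIV. dir v (c i i) z)"
    using dir_det_at_identity[OF cd cz] by simp
  finally show ?thesis by (simp add: dc B_def)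
qed

text \<open>Squaring the determinant spares the discussion of its sign; the function is the logarithm of the square root of
  \<open>\<bar>det\<bar>\<close>.\<close>

lemma dir_ln_det:
  fixes a :: "'n::finite \<Rightarrow> 'n \<Rightarrow> 'a::real_normed_vector \<Rightarrow> real"
  assumes "\<And>i j. a i j differentiable (at z)" and "det (\<chi> i j. a i j z) \<noteq> 0"
  shows "dir v (\<lambda>x. 1/4 * ln ((det (\<chi> i j. a i j x))\<^sup>2)) z =
    1/2 * (\<Sum>j\<in>UNIV. \<Sum>k\<in>UNIV. matrix_inv (\<chi> i j. a i j z) $ j $ k * dir v (a k j) z)"
proof -
  let ?d = "\<lambda>x. det (\<chi> i j. a i j x)"
  have "?d differentiable (at z)" by (rule differentiable_det[OF assms(1)])
  then have D: "(?d has_derivative (\<lambda>v. dir v ?d z)) (at z)" by (rule has_derivative_dir)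
  have sq: "((\<lambda>x. (?d x)\<^sup>2) has_derivative (\<lambda>v. 2 * (?d z * dir v ?d z))) (at z)"
    by (auto intro!: derivative_eq_intros D)
  have pos: "0 < (?d z)\<^sup>2" using assms(2) by simp
  have "((\<lambda>x. 1/4 * ln ((?d x)\<^sup>2)) has_derivative (\<lambda>v. 1/4 * ((2 * (?d z * dir v ?d z)) * inverse ((?d z)\<^sup>2)))) (at z)"
    by (rule has_derivative_mult_right[OF has_derivative_ln[OF pos sq]])
  from dir_unique[OF this] dir_det[OF assms] show ?thesis using assms(2)
    by (simp add: power2_eq_square field_simps)
qed

section \<open>Induced coordinates\<close>

abbreviation ex :: "'n \<Rightarrow> (real^'n::finite) \<times> (real^'n)" where "ex i \<equiv> (axis i 1, 0)"
abbreviation ey :: "'n \<Rightarrow> (real^'n::finite) \<times> (real^'n)" where "ey i \<equiv> (0, axis i 1)"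

lemma dx_eq_dir: "dx i f = dir (ex i) f" by (auto simp: dx_def dir_def)
lemma dy_eq_dir: "dy i f = dir (ey i) f" by (auto simp: dy_def dir_def)
lemma pderiv_at_eq_dir: "pderiv_at k f = dir (axis k 1) f" by (auto simp: pderiv_at_def dir_def)

lemma dir_vec_expand:
  fixes f :: "real^'n::finite \<Rightarrow> real"
  assumes "f differentiable (at x)"
  shows "dir v f x = (\<Sum>i\<in>UNIV. v $ i * dir (axis i 1) f x)"
proof -
  have "dir v f x = dir (\<Sum>i\<in>UNIV. v $ i *\<^sub>R axis i 1) f x"
    using basis_expansion[of v] by (simp add: scalar_mult_eq_scaleR)
  then show ?thesis
    by (simp add: linear_sum[OF linear_dir[OF assms]] linear_cmul[OF linear_dir[OF assms]])
qed

lemma dir_expand: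
  fixes f :: "(real^'n::finite) \<times> (real^'n) \<Rightarrow> real"
  assumes "f differentiable (at z)"
  shows "dir v f z = (\<Sum>i\<in>UNIV. fst v $ i * dir (ex i) f z) + (\<Sum>i\<in>UNIV. snd v $ i * dir (ey i) f z)"
proof -
  have "v = (\<Sum>i\<in>UNIV. (fst v $ i) *\<^sub>R ex i) + (\<Sum>i\<in>UNIV. (snd v $ i) *\<^sub>R ey i)"
    using basis_expansion[of "fst v"] basis_expansion[of "snd v"]
    by (simp add: prod_eq_iff fst_sum snd_sum scalar_mult_eq_scaleR)
  then have "dir v f z = dir ((\<Sum>i\<in>UNIV. (fst v $ i) *\<^sub>R ex i) + (\<Sum>i\<in>UNIV. (snd v $ i) *\<^sub>R ey i)) f z"
    by (rule arg_cong)
  then show ?thesis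
    by (simp only: linear_add[OF linear_dir[OF assms]] linear_sum[OF linear_dir[OF assms]]
        linear_cmul[OF linear_dir[OF assms]] real_scaleR_def)
qed

lemma bounded_linear_fst_nth: "bounded_linear (\<lambda>w::(real^'n::finite) \<times> (real^'n). fst w $ k)"
  by (rule bounded_linear_compose[OF bounded_linear_vec_nth bounded_linear_fst])
lemma bounded_linear_snd_nth: "bounded_linear (\<lambda>w::(real^'n::finite) \<times> (real^'n). snd w $ k)"
  by (rule bounded_linear_compose[OF bounded_linear_vec_nth bounded_linear_snd])

lemma differentiable_vec_pairI:
  fixes W :: "'a::real_normed_vector \<Rightarrow> (real^'n::finite) \<times> (real^'n)"
  assumes "\<And>i. (\<lambda>z. fst (W z) $ i) differentiable (at z)" "\<And>i. (\<lambda>z. snd (W z) $ i) differentiable (at z)"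
  shows "W differentiable (at z)"
proof -
  have "(\<lambda>z. (\<Sum>i\<in>UNIV. (fst (W z) $ i) *\<^sub>R ex i) + (\<Sum>i\<in>UNIV. (snd (W z) $ i) *\<^sub>R ey i)) differentiable (at z)"
    using assms by (intro differentiable_add differentiable_sum ballI differentiable_scaleR) auto
  moreover have "(\<Sum>i\<in>UNIV. (fst v $ i) *\<^sub>R ex i) + (\<Sum>i\<in>UNIV. (snd v $ i) *\<^sub>R ey i) = v"
    for v :: "(real^'n) \<times> (real^'n)"
    using basis_expansion[of "fst v"] basis_expansion[of "snd v"]
    by (simp add: prod_eq_iff fst_sum snd_sum scalar_mult_eq_scaleR)
  ultimately show ?thesis by simp
qed

lemma sum_kronecker:
  fixes f :: "'n::finite \<Rightarrow> real"
  shows "(\<Sum>m\<in>UNIV. (if l = m then 1 else 0) * f m) = f l"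
proof -
  have "(\<Sum>m\<in>UNIV. (if l = m then 1 else 0) * f m) = (\<Sum>m\<in>UNIV. if l = m then f m else 0)"
    by (intro sum.cong) auto
  then show ?thesis by simp
qed

lemma dir_vec_pair:
  fixes W :: "'a::real_normed_vector \<Rightarrow> (real^'n::finite) \<times> (real^'n)"
  assumes "W differentiable (at z)"
  shows "fst (dir v W z) $ i = dir v (\<lambda>z. fst (W z) $ i) z" "snd (dir v W z) $ i = dir v (\<lambda>z. snd (W z) $ i) z"
  using dir_linear[OF bounded_linear_fst_nth assms] dir_linear[OF bounded_linear_snd_nth assms] by auto

section \<open>Functions on the slit coordinate domain and homogeneity\<close>

locale slit_domain =
  fixes U :: "(real^'n::finite) set"
  assumes open_U: "open U"
begin

abbreviation Z :: "((real^'n) \<times> (real^'n)) set" where "Z \<equiv> U \<times> (UNIV - {0})"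

lemma open_Z: "open Z" by (intro open_Times open_U open_Diff) auto

lemma fst_Z: "z \<in> Z \<Longrightarrow> fst z \<in> U" by auto

lemma smooth_y: "smooth_on Z (\<lambda>z. snd z $ k)"
  by (rule smooth_on_linear[OF open_Z bounded_linear_snd_nth smooth_on_ident[OF open_Z]])

lemma smooth_base: "smooth_on U h \<Longrightarrow> smooth_on Z (\<lambda>z. h (fst z))"
  by (rule smooth_on_compose_fst[OF open_Z]) auto

lemmas smooth_simps = smooth_on_add[OF open_Z] smooth_on_mult[OF open_Z] smooth_on_diff[OF open_Z]
  smooth_on_minus[OF open_Z] smooth_on_divide_const[OF open_Z]
  smooth_on_sum[OF open_Z] smooth_on_const[OF open_Z] smooth_on_dir smooth_y smooth_base

lemma diff_Z: "smooth_on Z f \<Longrightarrow> z \<in> Z \<Longrightarrow> f differentiable (at z)"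
  by (rule smooth_on_differentiable)

lemma dir_y: "dir v (\<lambda>z::(real^'n) \<times> (real^'n). snd z $ k) z = snd v $ k"
  by (rule dir_unique[OF bounded_linear_imp_has_derivative[OF bounded_linear_snd_nth]])

lemma dir_base: "smooth_on U h \<Longrightarrow> z \<in> Z \<Longrightarrow> dir v (\<lambda>z. h (fst z)) z = dir (fst v) h (fst z)"
  by (rule dir_compose_fst[OF smooth_on_differentiable]) auto

lemma dir_cong_Z: "z \<in> Z \<Longrightarrow> (\<And>w. w \<in> Z \<Longrightarrow> f w = g w) \<Longrightarrow> dir v f z = dir v g z"
  by (rule dir_transform[OF open_Z])

lemmas dir_simps = dir_minus dir_divide_const dir_add dir_mult dir_diff dir_sum dir_y dir_base

text \<open>The derivative along the Euler field, which by Euler's theorem multiplies a function homogeneous of degree \<open>d\<close> in \<open>y\<close>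
  by \<open>d\<close>. Homogeneity enters all later computations in this infinitesimal form.\<close>

abbreviation euler :: "((real^'n) \<times> (real^'n) \<Rightarrow> real) \<Rightarrow> (real^'n) \<times> (real^'n) \<Rightarrow> real"
  where "euler f z \<equiv> dir (0, snd z) f z"

lemma euler_eq_sum: "smooth_on Z f \<Longrightarrow> z \<in> Z \<Longrightarrow> euler f z = (\<Sum>i\<in>UNIV. snd z $ i * dir (ey i) f z)"
  using dir_expand[OF diff_Z, of f z "(0, snd z)"] by simp

lemma euler_field:
  "((\<lambda>z. (0::real^'n, snd z :: real^'n)) has_derivative (\<lambda>v. (0, snd v))) (at z)"
  by (auto intro!: derivative_eq_intros)

lemma euler_homogeneous:
  assumes "f differentiable (at z)" "\<And>s. s > 0 \<Longrightarrow> f (fst z, s *\<^sub>R snd z) = s * f z"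
  shows "euler f z = f z"
proof -
  let ?g = "\<lambda>s. f ((fst z, 0) + s *\<^sub>R (0, snd z))"
  have "(?g has_real_derivative dir (0, snd z) f ((fst z, 0) + 1 *\<^sub>R (0, snd z))) (at 1)"
    by (rule has_real_derivative_along_line) (use assms(1) in simp)
  then have D: "(?g has_real_derivative euler f z) (at 1)" by simp
  have "((\<lambda>s. s * f z) has_real_derivative f z) (at 1)" by (auto intro!: derivative_eq_intros)
  then have "(?g has_real_derivative f z) (at 1)"
    by (rule has_field_derivative_transform_within_open[where S="{0<..}"]) (use assms(2) in auto)
  then show ?thesis using DERIV_unique D by blast
qed

text \<open>The commutator of the constant field \<open>v\<close> with the Euler field is the vertical part of \<open>v\<close>. Consequently a
  \<open>y\<close>-derivative lowers the degree of homogeneity by one and an \<open>x\<close>-derivative preserves it.\<close>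

lemma euler_dir:
  assumes "smooth_on Z f" "\<And>w. w \<in> Z \<Longrightarrow> euler f w = d * f w" "z \<in> Z"
  shows "euler (dir v f) z = d * dir v f z - dir (0, snd v) f z"
proof -
  have "dir v (\<lambda>w. euler f w) z = dir v (\<lambda>w. d * f w) z" by (rule dir_cong_Z[OF assms(3,2)])
  also have "\<dots> = d * dir v f z" by (simp add: dir_mult diff_Z assms)
  finally have "dir v (euler f) z = d * dir v f z" .
  moreover have "dir v (\<lambda>w. euler f w) z = dir v (dir (0, snd z) f) z + dir (0, snd v) f z"
    using dir_along(1)[OF open_Z assms(1,3), of "\<lambda>w. (0, snd w)" v] euler_field[of z]
      dir_unique[OF euler_field[of z]] by (auto simp: differentiable_def)
  ultimately show ?thesis using dir_commute[OF open_Z assms(1,3), of v "(0, snd z)"] by simp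
qed

lemma euler_dy:
  assumes "smooth_on Z f" "\<And>w. w \<in> Z \<Longrightarrow> euler f w = d * f w" "z \<in> Z"
  shows "euler (dir (ey i) f) z = (d - 1) * dir (ey i) f z"
  using euler_dir[OF assms, of "ey i"] by (simp add: left_diff_distrib)

lemma euler_dx:
  assumes "smooth_on Z f" "\<And>w. w \<in> Z \<Longrightarrow> euler f w = d * f w" "z \<in> Z"
  shows "euler (dir (ex i) f) z = d * dir (ex i) f z"
  using euler_dir[OF assms, of "ex i"] linear_0[OF linear_dir[OF diff_Z[OF assms(1,3)]]] by (simp add: zero_prod_def)

lemma dir_rotate:
  fixes f :: "(real^'n) \<times> (real^'n) \<Rightarrow> real"
  assumes "smooth_on Z f" "z \<in> Z"
  shows "dir u (dir v (dir w f)) z = dir v (dir w (dir u f)) z"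
proof -
  have "dir u (dir v (dir w f)) z = dir v (dir u (dir w f)) z"
    by (rule dir_commute[OF open_Z smooth_on_dir[OF assms(1)] assms(2)])
  also have "\<dots> = dir v (dir w (dir u f)) z"
    by (rule dir_cong_Z[OF assms(2) dir_commute[OF open_Z assms(1)]])
  finally show ?thesis .
qed

lemma dir_dir_sum:
  fixes f :: "'i \<Rightarrow> (real^'n) \<times> (real^'n) \<Rightarrow> real"
  assumes "\<And>k. smooth_on Z (f k)" "z \<in> Z"
  shows "dir v (dir u (\<lambda>w. \<Sum>k\<in>I. f k w)) z = (\<Sum>k\<in>I. dir v (dir u (f k)) z)"
proof -
  have "dir v (dir u (\<lambda>w. \<Sum>k\<in>I. f k w)) z = dir v (\<lambda>w. \<Sum>k\<in>I. dir u (f k) w) z"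
    by (rule dir_cong_Z[OF assms(2) dir_sum]) (rule diff_Z[OF assms(1)])
  also have "\<dots> = (\<Sum>k\<in>I. dir v (dir u (f k)) z)"
    by (rule dir_sum) (rule diff_Z[OF smooth_on_dir[OF assms(1)] assms(2)])
  finally show ?thesis .
qed

lemma dir_dir_mult:
  fixes f g :: "(real^'n) \<times> (real^'n) \<Rightarrow> real"
  assumes "smooth_on Z f" "smooth_on Z g" "z \<in> Z"
  shows "dir v (dir u (\<lambda>w. f w * g w)) z = dir v (dir u f) z * g z + dir u f z * dir v g z
      + dir v f z * dir u g z + f z * dir v (dir u g) z"
proof -
  have "dir v (dir u (\<lambda>w. f w * g w)) z = dir v (\<lambda>w. dir u f w * g w + f w * dir u g w) z"
    by (rule dir_cong_Z[OF assms(3) dir_mult]) (rule diff_Z[OF assms(1)] diff_Z[OF assms(2)], assumption)+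
  also have "\<dots> = dir v (dir u f) z * g z + dir u f z * dir v g z
      + (dir v f z * dir u g z + f z * dir v (dir u g) z)"
    using assms by (simp add: dir_add dir_mult diff_Z smooth_simps)
  finally show ?thesis by simp
qed

lemma dir_dir_combination:
  fixes a b c d :: "(real^'n) \<times> (real^'n) \<Rightarrow> real"
  assumes s: "smooth_on Z a" "smooth_on Z b" "smooth_on Z c" "smooth_on Z d" and z: "z \<in> Z"
  shows "dir v (dir u (\<lambda>w. 2 * a w - b w + 2 * c w - d w)) z =
    2 * dir v (dir u a) z - dir v (dir u b) z + 2 * dir v (dir u c) z - dir v (dir u d) z"
proof -
  have D: "dir u' (\<lambda>w. 2 * a w - b w + 2 * c w - d w) x = 2 * dir u' a x - dir u' b x + 2 * dir u' c x - dir u' d x"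
    if "smooth_on Z a" "smooth_on Z b" "smooth_on Z c" "smooth_on Z d" "x \<in> Z" for u' x and a b c d :: "(real^'n) \<times> (real^'n) \<Rightarrow> real"
    using that by (simp add: dir_add dir_diff dir_mult diff_Z smooth_simps)
  have "dir v (dir u (\<lambda>w. 2 * a w - b w + 2 * c w - d w)) z =
     dir v (\<lambda>w. 2 * dir u a w - dir u b w + 2 * dir u c w - dir u d w) z"
    by (rule dir_cong_Z[OF z D[OF s]])
  also have "\<dots> = 2 * dir v (dir u a) z - dir v (dir u b) z + 2 * dir v (dir u c) z - dir v (dir u d) z"
    by (rule D[OF s[THEN smooth_on_dir] z])
  finally show ?thesis .
qed

end

section \<open>The metric and the spray of a Finsler structure\<close>

locale finsler_chart = slit_domain U for U :: "(real^'n::finite) set" +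
  fixes F :: "(real^'n) \<times> (real^'n) \<Rightarrow> real"
  assumes smooth_F: "smooth_on Z F"
    and F_homogeneous: "z \<in> Z \<Longrightarrow> s > 0 \<Longrightarrow> F (fst z, s *\<^sub>R snd z) = s * F z"
    and fund_pos: "z \<in> Z \<Longrightarrow> w \<noteq> 0 \<Longrightarrow> (\<Sum>i\<in>UNIV. \<Sum>j\<in>UNIV. fund F i j z * w $ i * w $ j) > 0"
begin

abbreviation Fsq :: "(real^'n) \<times> (real^'n) \<Rightarrow> real" where "Fsq \<equiv> \<lambda>z. (F z)\<^sup>2"

lemma smooth_Fsq: "smooth_on Z Fsq"
  using smooth_on_mult[OF open_Z smooth_F smooth_F] by (simp add: power2_eq_square)

lemma euler_Fsq: assumes "z \<in> Z" shows "euler Fsq z = 2 * Fsq z"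
proof -
  have dF: "F differentiable (at z)" by (rule diff_Z[OF smooth_F assms])
  have "euler Fsq z = dir (0, snd z) (\<lambda>w. F w * F w) z" by (simp add: power2_eq_square)
  also have "\<dots> = 2 * F z * euler F z" by (simp add: dir_mult dF)
  finally show ?thesis using euler_homogeneous[OF dF F_homogeneous[OF assms]] by (simp add: power2_eq_square)
qed

lemma fund_eq: assumes "z \<in> Z" shows "fund F i j z = dir (ey j) (dir (ey i) Fsq) z / 2"
proof -
  have "fund F i j z = dir (ey j) (\<lambda>w. dir (ey i) Fsq w / 2) z"
    unfolding fund_def dy_eq_dir
    by (rule dir_cong_Z[OF assms]) (simp add: dir_divide_const diff_Z[OF smooth_Fsq])
  then show ?thesis by (simp add: dir_divide_const diff_Z[OF smooth_on_dir[OF smooth_Fsq] assms])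
qed

lemma smooth_fund: "smooth_on Z (fund F i j)"
proof (rule smooth_on_cong[OF open_Z])
  show "smooth_on Z (\<lambda>z. dir (ey j) (dir (ey i) Fsq) z / 2)" by (intro smooth_simps smooth_Fsq)
qed (simp add: fund_eq)

lemma dir_fund: assumes "z \<in> Z" shows "dir v (fund F i j) z = dir v (dir (ey j) (dir (ey i) Fsq)) z / 2"
proof -
  have "dir v (fund F i j) z = dir v (\<lambda>z. dir (ey j) (dir (ey i) Fsq) z / 2) z"
    by (rule dir_cong_Z[OF assms fund_eq])
  then show ?thesis by (simp add: dir_divide_const diff_Z[OF smooth_on_dir[OF smooth_on_dir[OF smooth_Fsq]] assms])
qed

lemma fund_sym: "z \<in> Z \<Longrightarrow> fund F i j z = fund F j i z"
  using dir_commute[OF open_Z smooth_Fsq] by (simp add: fund_eq)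

lemma dir_fund_sym: "z \<in> Z \<Longrightarrow> dir v (fund F i j) z = dir v (fund F j i) z"
  by (rule dir_cong_Z) (auto intro: fund_sym)

text \<open>The Cartan tensor \<open>\<partial>g\<^sub>i\<^sub>j/\<partial>y\<^sup>k\<close> is totally symmetric, being a third derivative of \<open>F\<^sup>2\<close>.\<close>

lemma dy_fund_sym: assumes "z \<in> Z" shows "dir (ey k) (fund F i j) z = dir (ey j) (fund F i k) z"
  using dir_commute[OF open_Z smooth_on_dir[OF smooth_Fsq] assms] by (simp add: dir_fund assms)

lemma euler_fund: assumes "z \<in> Z" shows "euler (fund F i j) z = 0"
proof -
  have 1: "euler (dir (ey i) Fsq) w = 1 * dir (ey i) Fsq w" if "w \<in> Z" for w
    using euler_dy[OF smooth_Fsq euler_Fsq that] by simp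
  have "euler (dir (ey j) (dir (ey i) Fsq)) z = 0"
    using euler_dy[OF smooth_on_dir[OF smooth_Fsq] 1 assms] by simp
  then show ?thesis by (simp add: dir_fund assms)
qed

abbreviation gmat :: "(real^'n) \<times> (real^'n) \<Rightarrow> real^'n^'n" where "gmat z \<equiv> \<chi> k l. fund F k l z"

lemma det_gmat: assumes "z \<in> Z" shows "det (gmat z) \<noteq> 0"
proof -
  have "w = 0" if "gmat z *v w = 0" for w
  proof (rule ccontr)
    assume "w \<noteq> 0"
    have "(\<Sum>j\<in>UNIV. fund F i j z * w $ i * w $ j) = w $ i * (gmat z *v w) $ i" for i
      by (simp add: matrix_vector_mult_def sum_distrib_left mult_ac)
    then have "(\<Sum>i\<in>UNIV. \<Sum>j\<in>UNIV. fund F i j z * w $ i * w $ j) = 0" by (simp add: that)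
    then show False using fund_pos[OF assms \<open>w \<noteq> 0\<close>] by simp
  qed
  then have "invertible (gmat z)" unfolding invertible_left_inverse matrix_left_invertible_ker by blast
  then show ?thesis by (simp add: invertible_det_nz)
qed

lemma fund_inv_left: "z \<in> Z \<Longrightarrow> (\<Sum>k\<in>UNIV. fund_inv F i k z * fund F k j z) = (if i = j then 1 else 0)"
proof -
  assume "z \<in> Z"
  then have "(matrix_inv (gmat z) ** gmat z) $ i $ j = mat 1 $ i $ j" using matrix_inv_mult[OF det_gmat] by simp
  then show ?thesis by (simp add: matrix_matrix_mult_def fund_inv_def mat_def)
qed

lemma fund_inv_right: "z \<in> Z \<Longrightarrow> (\<Sum>k\<in>UNIV. fund F i k z * fund_inv F k j z) = (if i = j then 1 else 0)"
proof -
  assume "z \<in> Z"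
  then have "(gmat z ** matrix_inv (gmat z)) $ i $ j = mat 1 $ i $ j" using matrix_inv_mult[OF det_gmat] by simp
  then show ?thesis by (simp add: matrix_matrix_mult_def fund_inv_def mat_def)
qed

lemma fund_inv_sym: assumes "z \<in> Z" shows "fund_inv F i j z = fund_inv F j i z"
proof -
  let ?A = "gmat z" and ?B = "matrix_inv (gmat z)"
  have AB: "?A ** ?B = mat 1" "?B ** ?A = mat 1" using matrix_inv_mult[OF det_gmat[OF assms]] by auto
  have "transpose ?A = ?A" by (simp add: transpose_def fund_sym[OF assms] vec_eq_iff)
  then have BA: "transpose ?B ** ?A = mat 1" using AB(1) by (metis matrix_transpose_mul transpose_mat)
  have "transpose ?B = transpose ?B ** (?A ** ?B)" by (simp only: AB matrix_mul_rid)
  also have "\<dots> = ?B" by (simp only: matrix_mul_assoc BA matrix_mul_lid)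
  finally have "transpose ?B = ?B" .
  then have "transpose ?B $ i $ j = ?B $ i $ j" by simp
  then show ?thesis by (simp add: transpose_def fund_inv_def)
qed

lemma smooth_fund_inv: "smooth_on Z (fund_inv F i j)"
  using smooth_on_matrix_inv[OF open_Z smooth_fund det_gmat, of i j]
  unfolding fund_inv_def[abs_def] by simp

text \<open>The spray with its index lowered by the metric. Derivatives of \<open>G\<^sup>i\<close> are computed from the equation
  \<open>g\<^sub>l\<^sub>i G\<^sup>i = G\<^sub>l\<close> (\<open>fund_spray\<close>), which avoids differentiating the inverse metric.\<close>

definition lower_spray :: "'n \<Rightarrow> (real^'n) \<times> (real^'n) \<Rightarrow> real"
  where "lower_spray l z = 1/4 * ((\<Sum>k\<in>UNIV. dir (ey l) (dir (ex k) Fsq) z * snd z $ k) - dir (ex l) Fsq z)"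

lemma smooth_lower_spray: "smooth_on Z (lower_spray l)"
  unfolding lower_spray_def[abs_def] by (intro smooth_simps smooth_Fsq)

lemma spray_eq: "spray F i z = (\<Sum>l\<in>UNIV. fund_inv F i l z * lower_spray l z)"
  by (simp add: spray_def lower_spray_def dx_eq_dir dy_eq_dir sum_distrib_left mult_ac)

lemma smooth_spray: "smooth_on Z (spray F i)"
  unfolding spray_eq[abs_def] by (intro smooth_simps smooth_fund_inv smooth_lower_spray)

lemma fund_spray: assumes "z \<in> Z" shows "(\<Sum>i\<in>UNIV. fund F l i z * spray F i z) = lower_spray l z"
proof -
  have "(\<Sum>i\<in>UNIV. fund F l i z * spray F i z)
      = (\<Sum>m\<in>UNIV. (\<Sum>i\<in>UNIV. fund F l i z * fund_inv F i m z) * lower_spray m z)"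
    unfolding spray_eq sum_distrib_left sum_distrib_right by (subst sum.swap) (simp add: mult.assoc)
  then show ?thesis by (simp add: fund_inv_right[OF assms] sum_kronecker)
qed

lemma fund_injective:
  assumes "z \<in> Z" "\<And>l. (\<Sum>i\<in>UNIV. fund F l i z * a i) = (\<Sum>i\<in>UNIV. fund F l i z * b i)"
  shows "a j = b j"
proof -
  have c: "(\<Sum>l\<in>UNIV. fund_inv F j l z * (\<Sum>i\<in>UNIV. fund F l i z * c i)) = c j" for c
  proof -
    have "(\<Sum>l\<in>UNIV. fund_inv F j l z * (\<Sum>i\<in>UNIV. fund F l i z * c i))
      = (\<Sum>i\<in>UNIV. (\<Sum>l\<in>UNIV. fund_inv F j l z * fund F l i z) * c i)"
      unfolding sum_distrib_left sum_distrib_right by (subst sum.swap) (simp add: mult.assoc)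
    then show ?thesis by (simp add: fund_inv_left[OF assms(1)] sum_kronecker)
  qed
  show ?thesis using c[of a] c[of b] assms(2) by simp
qed

text \<open>Comparing degrees in \<open>g\<^sub>l\<^sub>i G\<^sup>i = G\<^sub>l\<close>: the metric has degree \<open>0\<close> and the lowered spray has degree \<open>2\<close>.\<close>

lemma euler_spray: assumes z: "z \<in> Z" shows "euler (spray F j) z = 2 * spray F j z"
proof (rule fund_injective[OF z])
  fix l
  have 1: "euler (dir (ex k) Fsq) w = 2 * dir (ex k) Fsq w" if "w \<in> Z" for w k
    using euler_dx[OF smooth_Fsq euler_Fsq that] by simp
  have 2: "euler (dir (ey l) (dir (ex k) Fsq)) w = dir (ey l) (dir (ex k) Fsq) w" if "w \<in> Z" for w k
    using euler_dy[OF smooth_on_dir[OF smooth_Fsq] 1 that] by simp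
  have 3: "euler (lower_spray l) z = 2 * lower_spray l z"
    unfolding lower_spray_def[abs_def] using z
    by (simp add: dir_simps diff_Z smooth_simps smooth_Fsq 1 2 sum.distrib algebra_simps sum_distrib_left)
  have "euler (lower_spray l) z = euler (\<lambda>w. \<Sum>i\<in>UNIV. fund F l i w * spray F i w) z"
    by (rule dir_cong_Z[OF z]) (simp add: fund_spray)
  also have "\<dots> = (\<Sum>i\<in>UNIV. fund F l i z * euler (spray F i) z)"
    using z by (simp add: dir_simps diff_Z smooth_simps smooth_fund smooth_spray euler_fund)
  finally show "(\<Sum>i\<in>UNIV. fund F l i z * euler (spray F i) z) = (\<Sum>i\<in>UNIV. fund F l i z * (2 * spray F i z))"
    using fund_spray[OF z, of l] by (simp add: 3 mult.left_commute flip: sum_distrib_left)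
qed

section \<open>The trace of the nonlinear connection\<close>

definition spray_trace :: "(real^'n) \<times> (real^'n) \<Rightarrow> real"
  where "spray_trace z = (\<Sum>m\<in>UNIV. dir (ey m) (spray F m) z)"

lemma smooth_spray_trace: "smooth_on Z spray_trace"
  unfolding spray_trace_def[abs_def] by (intro smooth_simps smooth_spray)

lemma euler_spray_trace: assumes "z \<in> Z" shows "euler spray_trace z = spray_trace z"
proof -
  have "euler (dir (ey m) (spray F m)) z = dir (ey m) (spray F m) z" for m
    using euler_dy[OF smooth_spray euler_spray assms] by simp
  then show ?thesis unfolding spray_trace_def[abs_def] using assms
    by (simp add: dir_simps diff_Z smooth_simps smooth_spray)
qed

text \<open>The logarithm of the square root of \<open>det g\<close>, the density of a Riemannian volume on each fibre.\<close>

definition log_volume :: "(real^'n) \<times> (real^'n) \<Rightarrow> real"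
  where "log_volume z = 1/4 * ln ((det (gmat z))\<^sup>2)"

lemma smooth_log_volume: "smooth_on Z log_volume"
proof -
  have "smooth_on Z (\<lambda>z. (det (gmat z))\<^sup>2)"
    unfolding power2_eq_square by (intro smooth_simps smooth_on_det[OF open_Z] smooth_fund)
  then show ?thesis unfolding log_volume_def[abs_def]
    by (intro smooth_simps smooth_on_ln[OF open_Z]) (use det_gmat in auto)
qed

text \<open>By Jacobi's formula. For the vertical directions the right-hand side is the definition of the mean Cartan torsion, and
  for the Euler field it vanishes.\<close>

lemma dir_log_volume: assumes "z \<in> Z"
  shows "dir v log_volume z = 1/2 * (\<Sum>j\<in>UNIV. \<Sum>k\<in>UNIV. fund_inv F j k z * dir v (fund F j k) z)"
  using dir_ln_det[of "fund F" z v, OF diff_Z[OF smooth_fund assms] det_gmat[OF assms]] dir_fund_sym[OF assms, of v]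
  unfolding log_volume_def[abs_def] fund_inv_def by (simp only:)

lemma mean_Cartan_eq: "z \<in> Z \<Longrightarrow> mean_Cartan F i z = dir (ey i) log_volume z"
  by (simp add: dir_log_volume mean_Cartan_def dy_eq_dir)

lemma euler_log_volume: "z \<in> Z \<Longrightarrow> euler log_volume z = 0"
  by (simp add: dir_log_volume euler_fund)

text \<open>The geodesic spray as a vector field on the slit domain.\<close>

definition geod :: "(real^'n) \<times> (real^'n) \<Rightarrow> (real^'n) \<times> (real^'n)"
  where "geod z = (snd z, \<chi> i. - 2 * spray F i z)"

lemma dir_geod: "smooth_on Z f \<Longrightarrow> z \<in> Z \<Longrightarrow> dir (geod z) f z =
    (\<Sum>k\<in>UNIV. snd z $ k * dir (ex k) f z) - 2 * (\<Sum>k\<in>UNIV. spray F k z * dir (ey k) f z)"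
  using dir_expand[OF diff_Z, of f z "geod z"] by (simp add: geod_def sum_negf sum_distrib_left mult.assoc)

text \<open>Differentiating \<open>g\<^sub>l\<^sub>i G\<^sup>i = G\<^sub>l\<close> by \<open>y\<^sup>j\<close> and contracting with \<open>g\<^sup>j\<^sup>l\<close> produces the trace
  \<open>N\<^sup>m\<^sub>m\<close> from the derivative of \<open>G\<^sup>i\<close>, and derivatives of \<open>log_volume\<close> from those of \<open>g\<close>. The identity
  reflects that the metric is parallel along geodesics.\<close>

lemma spray_trace_eq_dir_geod_log_volume: assumes z: "z \<in> Z" shows "spray_trace z = dir (geod z) log_volume z"
proof -
  let ?g = "\<lambda>j l. fund_inv F j l z"
  \<comment> \<open>The \<open>y\<^sup>j\<close>-derivative of the lowered equation; total symmetry of the Cartan tensor turns \<open>\<partial>g\<^sub>l\<^sub>i/\<partial>y\<^sup>j\<close> into \<open>\<partial>g\<^sub>j\<^sub>l/\<partial>y\<^sup>i\<close>.\<close>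
  have eq: "(\<Sum>i\<in>UNIV. dir (ey i) (fund F j l) z * spray F i z) + (\<Sum>i\<in>UNIV. fund F l i z * dir (ey j) (spray F i) z)
     = 1/2 * (\<Sum>k\<in>UNIV. snd z $ k * dir (ex k) (fund F j l) z)
       + 1/4 * (dir (ex j) (dir (ey l) Fsq) z - dir (ex l) (dir (ey j) Fsq) z)" for j l
  proof -
    have "dir (ey j) (\<lambda>w. \<Sum>i\<in>UNIV. fund F l i w * spray F i w) z = dir (ey j) (lower_spray l) z"
      by (rule dir_cong_Z[OF z fund_spray])
    moreover have "dir (ey j) (\<lambda>w. \<Sum>i\<in>UNIV. fund F l i w * spray F i w) z =
       (\<Sum>i\<in>UNIV. dir (ey i) (fund F j l) z * spray F i z) + (\<Sum>i\<in>UNIV. fund F l i z * dir (ey j) (spray F i) z)"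
      using z dy_fund_sym[OF z, of j l] dir_fund_sym[OF z, of _ l j]
      by (simp add: dir_simps diff_Z smooth_simps smooth_fund smooth_spray sum.distrib)
    moreover have "dir (ey j) (lower_spray l) z = 1/4 * ((\<Sum>k\<in>UNIV. dir (ey j) (dir (ey l) (dir (ex k) Fsq)) z * snd z $ k
        + dir (ey l) (dir (ex k) Fsq) z * axis j 1 $ k) - dir (ey j) (dir (ex l) Fsq) z)"
      unfolding lower_spray_def[abs_def] using z by (simp add: dir_simps diff_Z smooth_simps smooth_Fsq)
    moreover have "dir (ey j) (dir (ey l) (dir (ex k) Fsq)) z = 2 * dir (ex k) (fund F j l) z" for k
    proof -
      have "dir (ey j) (dir (ey l) (dir (ex k) Fsq)) z = dir (ey j) (dir (ex k) (dir (ey l) Fsq)) z"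
        by (rule dir_cong_Z[OF z dir_commute[OF open_Z smooth_Fsq]])
      also have "\<dots> = dir (ex k) (dir (ey j) (dir (ey l) Fsq)) z" by (rule dir_commute[OF open_Z smooth_on_dir[OF smooth_Fsq] z])
      finally show ?thesis using dir_fund[OF z, of "ex k" l j] dir_fund_sym[OF z, of "ex k" l j] by simp
    qed
    moreover have "(\<Sum>k\<in>UNIV. dir (ey l) (dir (ex k) Fsq) z * axis j 1 $ k) = dir (ex j) (dir (ey l) Fsq) z"
      using dir_commute[OF open_Z smooth_Fsq z, of "ey l" "ex j"] by (simp add: axis_def if_distrib cong: if_cong)
    moreover have "dir (ey j) (dir (ex l) Fsq) z = dir (ex l) (dir (ey j) Fsq) z" by (rule dir_commute[OF open_Z smooth_Fsq z])
    ultimately show ?thesis by (simp add: sum.distrib sum_distrib_left algebra_simps)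
  qed
  have A: "(\<Sum>j\<in>UNIV. \<Sum>l\<in>UNIV. ?g j l * (\<Sum>i\<in>UNIV. dir (ey i) (fund F j l) z * spray F i z))
      = 2 * (\<Sum>i\<in>UNIV. spray F i z * dir (ey i) log_volume z)"
  proof -
    have "(\<Sum>j\<in>UNIV. \<Sum>l\<in>UNIV. ?g j l * (\<Sum>i\<in>UNIV. dir (ey i) (fund F j l) z * spray F i z))
       = (\<Sum>j\<in>UNIV. \<Sum>i\<in>UNIV. \<Sum>l\<in>UNIV. spray F i z * (?g j l * dir (ey i) (fund F j l) z))"
      unfolding sum_distrib_left by (subst (2) sum.swap) (simp add: mult_ac)
    also have "\<dots> = (\<Sum>i\<in>UNIV. spray F i z * (\<Sum>j\<in>UNIV. \<Sum>l\<in>UNIV. ?g j l * dir (ey i) (fund F j l) z))"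
      unfolding sum_distrib_left by (subst sum.swap) simp
    finally show ?thesis by (simp add: dir_log_volume[OF z] sum_distrib_left mult_ac)
  qed
  have B: "(\<Sum>j\<in>UNIV. \<Sum>l\<in>UNIV. ?g j l * (\<Sum>k\<in>UNIV. snd z $ k * dir (ex k) (fund F j l) z))
      = 2 * (\<Sum>k\<in>UNIV. snd z $ k * dir (ex k) log_volume z)"
  proof -
    have "(\<Sum>j\<in>UNIV. \<Sum>l\<in>UNIV. ?g j l * (\<Sum>k\<in>UNIV. snd z $ k * dir (ex k) (fund F j l) z))
       = (\<Sum>j\<in>UNIV. \<Sum>i\<in>UNIV. \<Sum>l\<in>UNIV. snd z $ i * (?g j l * dir (ex i) (fund F j l) z))"
      unfolding sum_distrib_left by (subst (2) sum.swap) (simp add: mult_ac)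
    also have "\<dots> = (\<Sum>i\<in>UNIV. snd z $ i * (\<Sum>j\<in>UNIV. \<Sum>l\<in>UNIV. ?g j l * dir (ex i) (fund F j l) z))"
      unfolding sum_distrib_left by (subst sum.swap) simp
    finally show ?thesis by (simp add: dir_log_volume[OF z] sum_distrib_left mult_ac)
  qed
  have C: "(\<Sum>j\<in>UNIV. \<Sum>l\<in>UNIV. ?g j l * (\<Sum>i\<in>UNIV. fund F l i z * dir (ey j) (spray F i) z)) = spray_trace z"
  proof -
    have "(\<Sum>l\<in>UNIV. ?g j l * (\<Sum>i\<in>UNIV. fund F l i z * dir (ey j) (spray F i) z)) = dir (ey j) (spray F j) z" for j
    proof -
      have "(\<Sum>l\<in>UNIV. ?g j l * (\<Sum>i\<in>UNIV. fund F l i z * dir (ey j) (spray F i) z))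
        = (\<Sum>i\<in>UNIV. (\<Sum>l\<in>UNIV. ?g j l * fund F l i z) * dir (ey j) (spray F i) z)"
        unfolding sum_distrib_left sum_distrib_right by (subst sum.swap) (simp add: mult.assoc)
      then show ?thesis by (simp add: fund_inv_left[OF z] sum_kronecker)
    qed
    then show ?thesis by (simp add: spray_trace_def)
  qed
  \<comment> \<open>The part antisymmetric in \<open>j\<close> and \<open>l\<close> is killed by the symmetric inverse metric.\<close>
  have D: "(\<Sum>j\<in>UNIV. \<Sum>l\<in>UNIV. ?g j l * (dir (ex j) (dir (ey l) Fsq) z - dir (ex l) (dir (ey j) Fsq) z)) = 0"
  proof -
    have "(\<Sum>j\<in>UNIV. \<Sum>l\<in>UNIV. ?g j l * dir (ex j) (dir (ey l) Fsq) z) =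
       (\<Sum>j\<in>UNIV. \<Sum>l\<in>UNIV. ?g j l * dir (ex l) (dir (ey j) Fsq) z)"
      by (subst sum.swap) (simp add: fund_inv_sym[OF z])
    then show ?thesis by (simp add: right_diff_distrib sum_subtractf)
  qed
  have lin: "(\<Sum>j\<in>UNIV. \<Sum>l\<in>UNIV. ?g j l * (1/2 * a j l + 1/4 * b j l))
     = 1/2 * (\<Sum>j\<in>UNIV. \<Sum>l\<in>UNIV. ?g j l * a j l) + 1/4 * (\<Sum>j\<in>UNIV. \<Sum>l\<in>UNIV. ?g j l * b j l)"
    for a b :: "'n \<Rightarrow> 'n \<Rightarrow> real"
    by (simp add: sum.distrib sum_distrib_left algebra_simps)
  have "(\<Sum>j\<in>UNIV. \<Sum>l\<in>UNIV. ?g j l * ((\<Sum>i\<in>UNIV. dir (ey i) (fund F j l) z * spray F i z) +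
       (\<Sum>i\<in>UNIV. fund F l i z * dir (ey j) (spray F i) z)))
     = (\<Sum>j\<in>UNIV. \<Sum>l\<in>UNIV. ?g j l * (1/2 * (\<Sum>k\<in>UNIV. snd z $ k * dir (ex k) (fund F j l) z)
       + 1/4 * (dir (ex j) (dir (ey l) Fsq) z - dir (ex l) (dir (ey j) Fsq) z)))"
    by (simp only: eq)
  also have "\<dots> = 1/2 * (\<Sum>j\<in>UNIV. \<Sum>l\<in>UNIV. ?g j l * (\<Sum>k\<in>UNIV. snd z $ k * dir (ex k) (fund F j l) z))
     + 1/4 * (\<Sum>j\<in>UNIV. \<Sum>l\<in>UNIV. ?g j l * (dir (ex j) (dir (ey l) Fsq) z - dir (ex l) (dir (ey j) Fsq) z))"
    by (rule lin)
  finally have "2 * (\<Sum>i\<in>UNIV. spray F i z * dir (ey i) log_volume z) + spray_trace z = (\<Sum>k\<in>UNIV. snd z $ k * dir (ex k) log_volume z)"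
    unfolding distrib_left[of "?g _ _"] sum.distrib A B C D by simp
  then show ?thesis by (simp add: dir_geod[OF smooth_log_volume z])
qed

end

section \<open>The complete lift and its commutators\<close>

locale I_projective_chart = finsler_chart U F for U :: "(real^'n::finite) set" and F +
  fixes X :: "real^'n \<Rightarrow> real^'n" and Psi :: "(real^'n) \<times> (real^'n) \<Rightarrow> real"
  assumes smooth_X: "smooth_on U X"
    and Psi_homogeneous: "z \<in> Z \<Longrightarrow> s > 0 \<Longrightarrow> Psi (fst z, s *\<^sub>R snd z) = s * Psi z"
    and lie_spray_Psi: "z \<in> Z \<Longrightarrow> lie_spray X (spray F) i z = Psi z * snd z $ i"
    and lie_mean_Cartan: "z \<in> Z \<Longrightarrow> lie_covector X (mean_Cartan F) i z = 0"
begin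

abbreviation DX :: "'n \<Rightarrow> 'n \<Rightarrow> real^'n \<Rightarrow> real" where "DX k r \<equiv> dir (axis k 1) (\<lambda>x. X x $ r)"
abbreviation DDX :: "'n \<Rightarrow> 'n \<Rightarrow> 'n \<Rightarrow> real^'n \<Rightarrow> real" where "DDX j k r \<equiv> dir (axis j 1) (DX k r)"

definition Xhat :: "(real^'n) \<times> (real^'n) \<Rightarrow> (real^'n) \<times> (real^'n)"
  where "Xhat z = (X (fst z), \<chi> r. \<Sum>k\<in>UNIV. snd z $ k * DX k r (fst z))"

lemma smooth_X_nth: "smooth_on U (\<lambda>x. X x $ r)"
  by (rule smooth_on_linear[OF open_U bounded_linear_vec_nth smooth_X])

lemma DDX_sym: "x \<in> U \<Longrightarrow> DDX j k r x = DDX k j r x"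
  by (rule dir_commute[OF open_U smooth_X_nth])

lemma dir_Xhat: "smooth_on Z f \<Longrightarrow> z \<in> Z \<Longrightarrow> dir (Xhat z) f z =
    (\<Sum>i\<in>UNIV. X (fst z) $ i * dir (ex i) f z)
    + (\<Sum>i\<in>UNIV. \<Sum>k\<in>UNIV. snd z $ k * DX k i (fst z) * dir (ey i) f z)"
  using dir_expand[OF diff_Z, of f z "Xhat z"] by (simp add: Xhat_def sum_distrib_right)

text \<open>The complete lift is the derivation given by the vector field \<open>Xhat\<close>, so the calculus of commutators applies to it.\<close>

lemma complete_lift_eq: "smooth_on Z f \<Longrightarrow> z \<in> Z \<Longrightarrow> complete_lift X f z = dir (Xhat z) f z"
  by (simp add: dir_Xhat complete_lift_def dx_eq_dir dy_eq_dir pderiv_at_eq_dir)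

lemma smooth_dir_Xhat: fixes f :: "(real^'n) \<times> (real^'n) \<Rightarrow> real"
  assumes "smooth_on Z f" shows "smooth_on Z (\<lambda>z. dir (Xhat z) f z)"
proof (rule smooth_on_cong[OF open_Z dir_Xhat[OF assms, symmetric]])
  show "smooth_on Z (\<lambda>z. (\<Sum>i\<in>UNIV. X (fst z) $ i * dir (ex i) f z)
    + (\<Sum>i\<in>UNIV. \<Sum>k\<in>UNIV. snd z $ k * DX k i (fst z) * dir (ey i) f z))"
    by (intro smooth_simps smooth_base[OF smooth_X_nth] smooth_base[OF smooth_on_dir[OF smooth_X_nth]] assms)
qed

lemma smooth_dir_geod: fixes f :: "(real^'n) \<times> (real^'n) \<Rightarrow> real"
  assumes "smooth_on Z f" shows "smooth_on Z (\<lambda>z. dir (geod z) f z)"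
proof (rule smooth_on_cong[OF open_Z dir_geod[OF assms, symmetric]])
  show "smooth_on Z (\<lambda>z. (\<Sum>k\<in>UNIV. snd z $ k * dir (ex k) f z) - 2 * (\<Sum>k\<in>UNIV. spray F k z * dir (ey k) f z))"
    by (intro smooth_simps smooth_spray assms)
qed

lemma Xhat_differentiable: "z \<in> Z \<Longrightarrow> Xhat differentiable (at z)"
  by (rule differentiable_vec_pairI)
    (auto simp: Xhat_def intro!: diff_Z smooth_on_mult[OF open_Z] smooth_on_sum[OF open_Z] smooth_y
      smooth_base smooth_X_nth smooth_on_dir)

lemma geod_differentiable: "z \<in> Z \<Longrightarrow> geod differentiable (at z)"
  by (rule differentiable_vec_pairI)
    (auto simp: geod_def intro!: diff_Z smooth_on_minus[OF open_Z] smooth_on_mult[OF open_Z] smooth_y smooth_on_const[OF open_Z] smooth_spray)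

lemma dir_geod_field: assumes "z \<in> Z"
  shows "fst (dir v geod z) $ i = snd v $ i" "snd (dir v geod z) $ i = - 2 * dir v (spray F i) z"
  unfolding dir_vec_pair[OF geod_differentiable[OF assms]] using assms
  by (simp_all add: geod_def dir_simps diff_Z smooth_spray smooth_simps)

lemma dir_Xhat_field: assumes "z \<in> Z"
  shows "fst (dir v Xhat z) $ i = dir (fst v) (\<lambda>x. X x $ i) (fst z)"
    "snd (dir v Xhat z) $ i = (\<Sum>k\<in>UNIV. snd v $ k * DX k i (fst z)) + (\<Sum>k\<in>UNIV. snd z $ k * dir (fst v) (DX k i) (fst z))"
  unfolding dir_vec_pair[OF Xhat_differentiable[OF assms]] using assms
  by (simp_all add: Xhat_def dir_base[OF smooth_X_nth] dir_simps diff_Z smooth_simps smooth_X_nth sum.distrib)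

lemma lie_spray_expand: assumes "z \<in> Z" shows "dir (Xhat z) (spray F i) z - (\<Sum>j\<in>UNIV. spray F j z * DX j i (fst z))
    + 1/2 * (\<Sum>j\<in>UNIV. \<Sum>k\<in>UNIV. snd z $ j * snd z $ k * DDX j k i (fst z)) = Psi z * snd z $ i"
  using lie_spray_Psi[OF assms, of i]
  by (simp add: lie_spray_def complete_lift_eq[OF smooth_spray assms] pderiv_at_eq_dir)

text \<open>The vertical components of the bracket are \<open>-2\<close> times the Lie derivative of the spray coefficients; its
  inhomogeneous Hessian term is what differentiating the fibre part of the complete lift along \<open>y\<close> contributes.\<close>

lemma bracket_Xhat_geod: assumes z: "z \<in> Z" shows "dir (Xhat z) geod z - dir (geod z) Xhat z = (0, (- 2 * Psi z) *\<^sub>R snd z)"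
proof -
  have x: "fst z \<in> U" using z by auto
  have d1: "(\<lambda>x. X x $ i) differentiable (at (fst z))" for i by (rule smooth_on_differentiable[OF smooth_X_nth x])
  have d2: "DX k i differentiable (at (fst z))" for i k
    by (rule smooth_on_differentiable[OF smooth_on_dir[OF smooth_X_nth] x])
  have "fst (dir (Xhat z) geod z) $ i = fst (dir (geod z) Xhat z) $ i" for i
    by (simp add: dir_geod_field[OF z] dir_Xhat_field[OF z] dir_vec_expand[OF d1, of "fst (geod z)"]) (simp add: geod_def Xhat_def)
  moreover have "snd (dir (Xhat z) geod z) $ i - snd (dir (geod z) Xhat z) $ i = - 2 * Psi z * snd z $ i" for i
  proof -
    have "snd (dir (geod z) Xhat z) $ i = - 2 * (\<Sum>k\<in>UNIV. spray F k z * DX k i (fst z))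
        + (\<Sum>k\<in>UNIV. \<Sum>j\<in>UNIV. snd z $ k * (snd z $ j * DDX j k i (fst z)))"
      by (simp add: dir_Xhat_field[OF z] dir_vec_expand[OF d2, of "fst (geod z)"])
        (simp add: geod_def sum_distrib_left sum_negf mult.assoc)
    also have "(\<Sum>k\<in>UNIV. \<Sum>j\<in>UNIV. snd z $ k * (snd z $ j * DDX j k i (fst z)))
        = (\<Sum>j\<in>UNIV. \<Sum>k\<in>UNIV. snd z $ j * snd z $ k * DDX j k i (fst z))"
      by (subst sum.swap) (simp add: mult_ac)
    finally show ?thesis using lie_spray_expand[OF z, of i] by (simp add: dir_geod_field[OF z] algebra_simps)
  qed
  ultimately show ?thesis by (simp add: prod_eq_iff vec_eq_iff)
qed

lemma dir_Xhat_dir_geod: assumes "smooth_on Z f" "z \<in> Z"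
  shows "dir (Xhat z) (\<lambda>x. dir (geod x) f x) z = dir (geod z) (\<lambda>x. dir (Xhat x) f x) z - 2 * Psi z * euler f z"
proof -
  have "(0, (- 2 * Psi z) *\<^sub>R snd z) = (- 2 * Psi z) *\<^sub>R (0::real^'n, snd z)" by simp
  then have "dir (0, (- 2 * Psi z) *\<^sub>R snd z) f z = - 2 * Psi z * euler f z"
    using linear_cmul[OF linear_dir[OF diff_Z[OF assms]], of "- 2 * Psi z" "(0, snd z)"] by (simp only: real_scaleR_def)
  then show ?thesis
    using vector_field_bracket[OF open_Z assms Xhat_differentiable[OF assms(2)] geod_differentiable[OF assms(2)]]
      bracket_Xhat_geod[OF assms(2)] by simp
qed

text \<open>The commutator of \<open>\<partial>/\<partial>y\<^sup>i\<close> with the complete lift is vertical. This is why \<open>y\<close>-derivatives of tensors are again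
  tensors, and it produces the covariant index terms of the Lie derivative.\<close>

lemma dir_y_dir_Xhat: assumes "smooth_on Z f" "z \<in> Z"
  shows "dir (ey i) (\<lambda>x. dir (Xhat x) f x) z = dir (Xhat z) (dir (ey i) f) z + (\<Sum>r\<in>UNIV. DX i r (fst z) * dir (ey r) f z)"
proof -
  have l0: "dir 0 h x = 0" if "h differentiable (at x)" for h :: "real^'n \<Rightarrow> real" and x
    using linear_0[OF linear_dir[OF that]] .
  have x: "fst z \<in> U" using assms(2) by auto
  have f0: "fst (dir (ey i) Xhat z) $ r = 0" for r
    using dir_Xhat_field(1)[OF assms(2), of "ey i" r] l0[OF smooth_on_differentiable[OF smooth_X_nth x]] by simp
  have f1: "snd (dir (ey i) Xhat z) $ r = DX i r (fst z)" for r
    using dir_Xhat_field(2)[OF assms(2), of "ey i" r] l0[OF smooth_on_differentiable[OF smooth_on_dir[OF smooth_X_nth] x]]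
    by (simp add: axis_def if_distrib[of "\<lambda>x. x * _"] cong: if_cong)
  have "dir (dir (ey i) Xhat z) f z = (\<Sum>r\<in>UNIV. DX i r (fst z) * dir (ey r) f z)"
    using dir_expand[OF diff_Z[OF assms], of "dir (ey i) Xhat z"] by (simp add: f0 f1)
  then show ?thesis
    using dir_along(1)[OF open_Z assms Xhat_differentiable[OF assms(2)], of "ey i"]
      dir_commute[OF open_Z assms, of "ey i" "Xhat z"] by simp
qed

text \<open>The factor is determined by the Lie derivative of the spray, through contraction with \<open>y\<close>, and thus inherits its smoothness.\<close>

lemma smooth_Psi: "smooth_on Z Psi"
proof (rule smooth_on_cong[OF open_Z])
  let ?l = "\<lambda>i z. dir (Xhat z) (spray F i) z - (\<Sum>j\<in>UNIV. spray F j z * DX j i (fst z))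
    + 1/2 * (\<Sum>j\<in>UNIV. \<Sum>k\<in>UNIV. snd z $ j * snd z $ k * DDX j k i (fst z))"
  have nz: "(\<Sum>i\<in>UNIV. snd z $ i * snd z $ i) \<noteq> 0" if "z \<in> Z" for z :: "(real^'n) \<times> (real^'n)"
  proof -
    have "snd z \<bullet> snd z \<noteq> 0" using that by auto
    then show ?thesis by (simp add: inner_vec_def)
  qed
  show "smooth_on Z (\<lambda>z. (\<Sum>i\<in>UNIV. ?l i z * snd z $ i) / (\<Sum>i\<in>UNIV. snd z $ i * snd z $ i))"
    by (intro smooth_on_divide[OF open_Z] nz smooth_on_mult[OF open_Z] smooth_on_sum[OF open_Z]
        smooth_on_add[OF open_Z] smooth_on_diff[OF open_Z] smooth_y smooth_on_const[OF open_Z] smooth_dir_Xhat smooth_spray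
        smooth_base[OF smooth_on_dir[OF smooth_X_nth]] smooth_base[OF smooth_on_dir[OF smooth_on_dir[OF smooth_X_nth]]])
  show "(\<Sum>i\<in>UNIV. ?l i z * snd z $ i) / (\<Sum>i\<in>UNIV. snd z $ i * snd z $ i) = Psi z" if "z \<in> Z" for z
    using nz[OF that] by (simp only: lie_spray_expand[OF that]) (simp add: mult.assoc flip: sum_distrib_left)
qed

lemma euler_Psi: "z \<in> Z \<Longrightarrow> euler Psi z = Psi z"
  using euler_homogeneous[OF diff_Z[OF smooth_Psi]] Psi_homogeneous by simp

text \<open>The \<open>y\<close>-derivative of \<open>\<pounds>G\<^sup>r = \<Psi> y\<^sup>r\<close>: the Lie derivative of the nonlinear connection is \<open>\<Psi>\<^sub>i y\<^sup>r + \<Psi> \<delta>\<^sup>r\<^sub>i\<close>.\<close>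

lemma lie_spray1: assumes z: "z \<in> Z" shows
  "dir (Xhat z) (dir (ey i) (spray F r)) z
   = (\<Sum>s\<in>UNIV. dir (ey i) (spray F s) z * DX s r (fst z))
     - (\<Sum>s\<in>UNIV. DX i s (fst z) * dir (ey s) (spray F r) z)
     - (\<Sum>k\<in>UNIV. snd z $ k * DDX i k r (fst z))
     + dir (ey i) Psi z * snd z $ r + (if r = i then Psi z else 0)"
proof -
  have x: "fst z \<in> U" using z by auto
  have b: "smooth_on U (DX k r)" "smooth_on U (DDX j k r)" for j k r
    by (intro smooth_on_dir smooth_X_nth)+
  have l0: "dir 0 h (fst z) = 0" if "smooth_on U h" for h :: "real^'n \<Rightarrow> real"
    using linear_0[OF linear_dir[OF smooth_on_differentiable[OF that x]]] .
  have ax: "(\<Sum>j\<in>UNIV. axis i 1 $ j * h j) = h i" for h :: "'n \<Rightarrow> real"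
    by (simp add: axis_def if_distrib[of "\<lambda>x. x * _"] cong: if_cong)
  have q: "dir (ey i) (\<lambda>w. \<Sum>j\<in>UNIV. \<Sum>k\<in>UNIV. snd w $ j * snd w $ k * DDX j k r (fst w)) z
     = 2 * (\<Sum>k\<in>UNIV. snd z $ k * DDX i k r (fst z))"
  proof -
    have "dir (ey i) (\<lambda>w. \<Sum>j\<in>UNIV. \<Sum>k\<in>UNIV. snd w $ j * snd w $ k * DDX j k r (fst w)) z
      = (\<Sum>j\<in>UNIV. \<Sum>k\<in>UNIV. axis i 1 $ j * (snd z $ k * DDX j k r (fst z)) + axis i 1 $ k * (snd z $ j * DDX j k r (fst z)))"
      using z by (simp add: dir_simps diff_Z smooth_simps b l0 algebra_simps)
    also have "\<dots> = (\<Sum>j\<in>UNIV. axis i 1 $ j * (\<Sum>k\<in>UNIV. snd z $ k * DDX j k r (fst z))) + (\<Sum>j\<in>UNIV. snd z $ j * DDX j i r (fst z))"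
      by (simp add: sum.distrib ax sum_distrib_left)
    finally show ?thesis by (simp add: ax DDX_sym[OF x, of _ i])
  qed
  have "dir (ey i) (\<lambda>w. dir (Xhat w) (spray F r) w - (\<Sum>j\<in>UNIV. spray F j w * DX j r (fst w))
    + 1/2 * (\<Sum>j\<in>UNIV. \<Sum>k\<in>UNIV. snd w $ j * snd w $ k * DDX j k r (fst w))) z = dir (ey i) (\<lambda>w. Psi w * snd w $ r) z"
    by (rule dir_cong_Z[OF z lie_spray_expand])
  also have "\<dots> = dir (ey i) Psi z * snd z $ r + (if r = i then Psi z else 0)"
    using z by (simp add: dir_simps diff_Z smooth_Psi smooth_simps axis_def)
  also have "dir (ey i) (\<lambda>w. dir (Xhat w) (spray F r) w - (\<Sum>j\<in>UNIV. spray F j w * DX j r (fst w))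
    + 1/2 * (\<Sum>j\<in>UNIV. \<Sum>k\<in>UNIV. snd w $ j * snd w $ k * DDX j k r (fst w))) z
    = dir (ey i) (\<lambda>w. dir (Xhat w) (spray F r) w) z - (\<Sum>j\<in>UNIV. dir (ey i) (spray F j) z * DX j r (fst z))
      + 1/2 * dir (ey i) (\<lambda>w. \<Sum>j\<in>UNIV. \<Sum>k\<in>UNIV. snd w $ j * snd w $ k * DDX j k r (fst w)) z"
    using z by (simp add: dir_add dir_diff dir_mult dir_divide_const dir_base dir_sum[of _ "\<lambda>j w. spray F j w * DX j r (fst w)"]
      diff_Z smooth_simps smooth_dir_Xhat smooth_spray b l0)
  finally show ?thesis by (simp add: q dir_y_dir_Xhat[OF smooth_spray z])
qed

section \<open>Fibrewise linearity of the projective factor\<close>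

definition div_X :: "real^'n \<Rightarrow> real" where "div_X x = (\<Sum>r\<in>UNIV. DX r r x)"

lemma smooth_div_X: "smooth_on U div_X"
  unfolding div_X_def[abs_def] by (intro smooth_on_sum[OF open_U] smooth_on_dir smooth_X_nth)

text \<open>In the trace of \<open>lie_spray1\<close> the tensorial terms cancel, and Euler's theorem gives \<open>y\<^sup>i \<Psi>\<^sub>i + n \<Psi> = (n + 1) \<Psi>\<close>.\<close>

lemma lie_spray_trace: assumes z: "z \<in> Z" shows
  "dir (Xhat z) spray_trace z = (CARD('n) + 1) * Psi z - (\<Sum>k\<in>UNIV. snd z $ k * dir (axis k 1) div_X (fst z))"
proof -
  have x: "fst z \<in> U" using z by auto
  have "dir (Xhat z) spray_trace z = (\<Sum>r\<in>UNIV. dir (Xhat z) (dir (ey r) (spray F r)) z)"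
    unfolding spray_trace_def[abs_def] using z by (simp add: dir_sum diff_Z smooth_simps smooth_spray)
  also have "\<dots> = (\<Sum>r\<in>UNIV. \<Sum>s\<in>UNIV. dir (ey r) (spray F s) z * DX s r (fst z))
     - (\<Sum>r\<in>UNIV. \<Sum>s\<in>UNIV. DX r s (fst z) * dir (ey s) (spray F r) z)
     - (\<Sum>r\<in>UNIV. \<Sum>k\<in>UNIV. snd z $ k * DDX r k r (fst z)) + euler Psi z + CARD('n) * Psi z"
    by (simp add: lie_spray1[OF z] sum.distrib sum_subtractf euler_eq_sum[OF smooth_Psi z] mult.commute)
  also have "(\<Sum>r\<in>UNIV. \<Sum>s\<in>UNIV. DX r s (fst z) * dir (ey s) (spray F r) z)
      = (\<Sum>r\<in>UNIV. \<Sum>s\<in>UNIV. dir (ey r) (spray F s) z * DX s r (fst z))"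
    by (subst sum.swap) (simp add: mult.commute)
  also have "(\<Sum>r\<in>UNIV. \<Sum>k\<in>UNIV. snd z $ k * DDX r k r (fst z)) = (\<Sum>k\<in>UNIV. snd z $ k * dir (axis k 1) div_X (fst z))"
  proof -
    have "dir (axis k 1) div_X (fst z) = (\<Sum>r\<in>UNIV. DDX k r r (fst z))" for k
      unfolding div_X_def[abs_def] by (rule dir_sum) (rule smooth_on_differentiable[OF smooth_on_dir[OF smooth_X_nth] x])
    then show ?thesis by (subst sum.swap) (simp add: DDX_sym[OF x] sum_distrib_left)
  qed
  finally show ?thesis by (simp add: euler_Psi[OF z] algebra_simps)
qed

text \<open>A volume density transforms with weight one, whence the divergence.\<close>

definition lie_log_volume :: "(real^'n) \<times> (real^'n) \<Rightarrow> real" where "lie_log_volume z = dir (Xhat z) log_volume z + div_X (fst z)"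

lemma smooth_lie_log_volume: "smooth_on Z lie_log_volume"
  unfolding lie_log_volume_def[abs_def] by (intro smooth_on_add[OF open_Z] smooth_dir_Xhat smooth_log_volume smooth_base smooth_div_X)

text \<open>Vertical differentiation commutes with the Lie derivative, so this is the Lie derivative of the mean Cartan torsion. It is
  the only place where the invariance of the torsion is used.\<close>

lemma dy_lie_log_volume: assumes z: "z \<in> Z" shows "dir (ey i) lie_log_volume z = 0"
proof -
  have x: "fst z \<in> U" using z by auto
  have "dir (ey i) lie_log_volume z = dir (ey i) (\<lambda>w. dir (Xhat w) log_volume w) z"
    unfolding lie_log_volume_def[abs_def]
    using z linear_0[OF linear_dir[OF smooth_on_differentiable[OF smooth_div_X x]]]
    by (simp add: dir_add dir_base diff_Z smooth_dir_Xhat smooth_log_volume smooth_base smooth_div_X)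
  also have "\<dots> = dir (Xhat z) (dir (ey i) log_volume) z + (\<Sum>r\<in>UNIV. DX i r (fst z) * dir (ey r) log_volume z)"
    by (rule dir_y_dir_Xhat[OF smooth_log_volume z])
  also have "\<dots> = lie_covector X (mean_Cartan F) i z"
  proof -
    have sm: "smooth_on Z (mean_Cartan F i)"
      by (rule smooth_on_cong[OF open_Z mean_Cartan_eq[symmetric] smooth_on_dir[OF smooth_log_volume]])
    have "dir (Xhat z) (mean_Cartan F i) z = dir (Xhat z) (dir (ey i) log_volume) z" by (rule dir_cong_Z[OF z mean_Cartan_eq])
    then show ?thesis
      by (simp add: lie_covector_def complete_lift_eq[OF sm z] pderiv_at_eq_dir mean_Cartan_eq[OF z] mult.commute)
  qed
  finally show ?thesis using lie_mean_Cartan[OF z] by simp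
qed

text \<open>Both sides come from differentiating \<open>spray_trace\<close> along the complete lift: once as a trace, and once as the derivative of
  \<open>log_volume\<close> along the spray, where the commutator term vanishes because \<open>log_volume\<close> has degree \<open>0\<close>.\<close>

lemma Psi_eq_dx_lie_log_volume: assumes z: "z \<in> Z" shows
  "(CARD('n) + 1) * Psi z = (\<Sum>k\<in>UNIV. snd z $ k * dir (ex k) lie_log_volume z)"
proof -
  have "dir (Xhat z) spray_trace z = dir (Xhat z) (\<lambda>w. dir (geod w) log_volume w) z" by (rule dir_cong_Z[OF z spray_trace_eq_dir_geod_log_volume])
  also have "\<dots> = dir (geod z) (\<lambda>w. dir (Xhat w) log_volume w) z"
    by (simp add: dir_Xhat_dir_geod[OF smooth_log_volume z] euler_log_volume[OF z])
  finally have 1: "dir (Xhat z) spray_trace z = dir (geod z) (\<lambda>w. dir (Xhat w) log_volume w) z" .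
  have "dir (geod z) lie_log_volume z = dir (geod z) (\<lambda>w. dir (Xhat w) log_volume w) z + dir (snd z) div_X (fst z)"
    unfolding lie_log_volume_def[abs_def] using z
    by (simp add: dir_add dir_base diff_Z smooth_dir_Xhat smooth_log_volume smooth_base smooth_div_X) (simp add: geod_def)
  moreover have "dir (snd z) div_X (fst z) = (\<Sum>k\<in>UNIV. snd z $ k * dir (axis k 1) div_X (fst z))"
    by (rule dir_vec_expand[OF smooth_on_differentiable[OF smooth_div_X]]) (use z in auto)
  moreover have "dir (geod z) lie_log_volume z = (\<Sum>k\<in>UNIV. snd z $ k * dir (ex k) lie_log_volume z)"
    by (simp add: dir_geod[OF smooth_lie_log_volume z] dy_lie_log_volume[OF z])
  ultimately show ?thesis using 1 lie_spray_trace[OF z] by simp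
qed

lemma dy_dx_lie_log_volume: assumes z: "z \<in> Z" shows "dir (ey i) (dir (ex k) lie_log_volume) z = 0"
proof -
  have "dir (ey i) (dir (ex k) lie_log_volume) z = dir (ex k) (dir (ey i) lie_log_volume) z" by (rule dir_commute[OF open_Z smooth_lie_log_volume z])
  also have "\<dots> = dir (ex k) (\<lambda>w. 0) z" by (rule dir_cong_Z[OF z dy_lie_log_volume])
  finally show ?thesis by simp
qed

text \<open>The function \<open>lie_log_volume\<close> has no vertical derivative, so the preceding formula is locally linear in \<open>y\<close>.\<close>

lemma ddy_Psi: assumes z: "z \<in> Z" shows "dir (ey i) (dir (ey j) Psi) z = 0"
proof -
  have 1: "(CARD('n) + 1) * dir (ey j) Psi w = dir (ex j) lie_log_volume w" if w: "w \<in> Z" for w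
  proof -
    have "(CARD('n) + 1) * dir (ey j) Psi w = dir (ey j) (\<lambda>w. (CARD('n) + 1) * Psi w) w"
      using dir_linear[OF bounded_linear_mult_right diff_Z[OF smooth_Psi w]] by metis
    also have "\<dots> = dir (ey j) (\<lambda>w. \<Sum>k\<in>UNIV. snd w $ k * dir (ex k) lie_log_volume w) w"
      by (rule dir_cong_Z[OF w Psi_eq_dx_lie_log_volume])
    also have "\<dots> = (\<Sum>k\<in>UNIV. axis j 1 $ k * dir (ex k) lie_log_volume w)"
      using w by (simp add: dir_simps diff_Z smooth_simps smooth_lie_log_volume dy_dx_lie_log_volume)
    finally show ?thesis by (simp add: axis_def if_distrib[of "\<lambda>x. x * _"] cong: if_cong)
  qed
  have "(CARD('n) + 1) * dir (ey i) (dir (ey j) Psi) z = dir (ey i) (\<lambda>w. (CARD('n) + 1) * dir (ey j) Psi w) z"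
    using dir_linear[OF bounded_linear_mult_right diff_Z[OF smooth_on_dir[OF smooth_Psi] z]] by metis
  also have "\<dots> = dir (ey i) (dir (ex j) lie_log_volume) z" by (rule dir_cong_Z[OF z 1])
  finally show ?thesis using dy_dx_lie_log_volume[OF z] by simp
qed

section \<open>Invariance of the mean Berwald curvature and its geodesic derivative\<close>

abbreviation hess :: "'n \<Rightarrow> 'n \<Rightarrow> (real^'n) \<times> (real^'n) \<Rightarrow> real" where "hess i j \<equiv> dir (ey i) (dir (ey j) spray_trace)"

lemma smooth_hess: "smooth_on Z (hess i j)" by (intro smooth_on_dir smooth_spray_trace)

lemma hess_sym: "z \<in> Z \<Longrightarrow> hess i j z = hess j i z" by (rule dir_commute[OF open_Z smooth_spray_trace])

text \<open>Two vertical derivatives annihilate the right-hand side of \<open>lie_spray_trace\<close>, while on the left they commute with the Lie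
  derivative.\<close>

lemma lie_hess: assumes z: "z \<in> Z" shows
  "dir (Xhat z) (hess i j) z = - (\<Sum>r\<in>UNIV. DX i r (fst z) * hess r j z) - (\<Sum>r\<in>UNIV. DX j r (fst z) * hess i r z)"
proof -
  have b: "smooth_on U (DX k r)" "smooth_on U (dir (axis k 1) div_X)" for k r
    by (intro smooth_on_dir smooth_X_nth smooth_div_X)+
  have l0: "dir 0 h (fst w) = 0" if "smooth_on U h" "w \<in> Z" for h :: "real^'n \<Rightarrow> real" and w
    using linear_0[OF linear_dir[OF smooth_on_differentiable[OF that(1) fst_Z[OF that(2)]]]] .
  have s: "smooth_on Z (dir (ey j) spray_trace)" by (intro smooth_on_dir smooth_spray_trace)
  have "dir (Xhat w) (dir (ey j) spray_trace) w + (\<Sum>r\<in>UNIV. DX j r (fst w) * dir (ey r) spray_trace w)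
      = (CARD('n) + 1) * dir (ey j) Psi w - dir (axis j 1) div_X (fst w)" if w: "w \<in> Z" for w
  proof -
    have "dir (Xhat w) (dir (ey j) spray_trace) w + (\<Sum>r\<in>UNIV. DX j r (fst w) * dir (ey r) spray_trace w) = dir (ey j) (\<lambda>w. dir (Xhat w) spray_trace w) w"
      by (rule dir_y_dir_Xhat[OF smooth_spray_trace w, symmetric])
    also have "\<dots> = dir (ey j) (\<lambda>w. (CARD('n) + 1) * Psi w - (\<Sum>k\<in>UNIV. snd w $ k * dir (axis k 1) div_X (fst w))) w"
      by (rule dir_cong_Z[OF w lie_spray_trace])
    also have "\<dots> = (CARD('n) + 1) * dir (ey j) Psi w - (\<Sum>k\<in>UNIV. axis j 1 $ k * dir (axis k 1) div_X (fst w))"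
      using w by (simp add: dir_simps diff_Z smooth_simps smooth_Psi b l0)
    finally show ?thesis by (simp add: axis_def if_distrib[of "\<lambda>x. x * _"] cong: if_cong)
  qed
  then have "dir (ey i) (\<lambda>w. dir (Xhat w) (dir (ey j) spray_trace) w + (\<Sum>r\<in>UNIV. DX j r (fst w) * dir (ey r) spray_trace w)) z
    = dir (ey i) (\<lambda>w. (CARD('n) + 1) * dir (ey j) Psi w - dir (axis j 1) div_X (fst w)) z"
    by (rule dir_cong_Z[OF z])
  also have "\<dots> = 0"
    using z by (simp add: dir_simps diff_Z smooth_simps smooth_Psi b l0 ddy_Psi)
  finally have "dir (ey i) (\<lambda>w. dir (Xhat w) (dir (ey j) spray_trace) w) z + (\<Sum>r\<in>UNIV. DX j r (fst z) * hess i r z) = 0"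
    using z by (simp add: dir_simps diff_Z smooth_simps smooth_spray_trace b l0 smooth_dir_Xhat[OF s])
  then show ?thesis using dir_y_dir_Xhat[OF s z, of i] by simp
qed

text \<open>The covariant derivative of \<open>hess\<close> along the geodesic spray for the Berwald connection.\<close>

definition hess_deriv :: "'n \<Rightarrow> 'n \<Rightarrow> (real^'n) \<times> (real^'n) \<Rightarrow> real"
  where "hess_deriv i j z = dir (geod z) (hess i j) z - (\<Sum>r\<in>UNIV. dir (ey i) (spray F r) z * hess r j z)
    - (\<Sum>r\<in>UNIV. dir (ey j) (spray F r) z * hess r i z)"

lemma smooth_hess_deriv: "smooth_on Z (hess_deriv i j)"
  unfolding hess_deriv_def[abs_def]
  by (intro smooth_on_diff[OF open_Z] smooth_dir_geod smooth_on_sum[OF open_Z] smooth_on_mult[OF open_Z] smooth_on_dir smooth_spray_trace smooth_spray)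

lemma euler_hess: assumes z: "z \<in> Z" shows "euler (hess i j) z = - hess i j z"
proof -
  have 1: "euler (dir (ey j) spray_trace) w = 0 * dir (ey j) spray_trace w" if "w \<in> Z" for w
    using euler_dy[OF smooth_spray_trace, of 1] euler_spray_trace that by simp
  show ?thesis using euler_dy[OF smooth_on_dir[OF smooth_spray_trace] 1 z] by simp
qed

text \<open>The trace has degree \<open>1\<close>, so its \<open>y\<close>-derivatives have degree \<open>0\<close>.\<close>

lemma contract_hess: assumes z: "z \<in> Z" shows "(\<Sum>r\<in>UNIV. snd z $ r * hess r j z) = 0"
  using euler_dy[OF smooth_spray_trace, of 1 z j] euler_spray_trace z euler_eq_sum[OF smooth_on_dir[OF smooth_spray_trace] z, of "ey j"] by simp

text \<open>One connection term of \<open>hess_deriv\<close>. It is not symmetric in \<open>i\<close> and \<open>j\<close>.\<close>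

definition conn_hess :: "'n \<Rightarrow> 'n \<Rightarrow> (real^'n) \<times> (real^'n) \<Rightarrow> real"
  where "conn_hess i j z = (\<Sum>r\<in>UNIV. dir (ey i) (spray F r) z * hess r j z)"

lemma smooth_conn_hess: "smooth_on Z (conn_hess i j)"
  unfolding conn_hess_def[abs_def] by (intro smooth_on_sum[OF open_Z] smooth_on_mult[OF open_Z] smooth_on_dir smooth_spray_trace smooth_spray)

text \<open>The first two sums are the index terms of a Lie derivative. The other two terms measure the failure of the connection term
  to be an invariant tensor: the Hessian of \<open>X\<close> from the transformation law of the connection, and \<open>\<Psi>\<close> from its Lie
  derivative.\<close>

lemma lie_conn_hess: assumes z: "z \<in> Z" shows
  "dir (Xhat z) (conn_hess i j) z = - (\<Sum>s\<in>UNIV. DX i s (fst z) * conn_hess s j z) - (\<Sum>s\<in>UNIV. DX j s (fst z) * conn_hess i s z)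
     - (\<Sum>r\<in>UNIV. (\<Sum>k\<in>UNIV. snd z $ k * DDX i k r (fst z)) * hess r j z) + Psi z * hess i j z"
proof -
  let ?N = "\<lambda>r i. dir (ey i) (spray F r) z" and ?D = "\<lambda>k r. DX k r (fst z)"
    and ?H = "\<lambda>r. \<Sum>k\<in>UNIV. snd z $ k * DDX i k r (fst z)"
  have "dir (Xhat z) (conn_hess i j) z = (\<Sum>r\<in>UNIV. dir (Xhat z) (dir (ey i) (spray F r)) z * hess r j z + ?N r i * dir (Xhat z) (hess r j) z)"
    unfolding conn_hess_def[abs_def] using z
    by (simp add: dir_sum dir_mult diff_Z smooth_simps smooth_spray smooth_spray_trace)
  also have "\<dots> = (\<Sum>r\<in>UNIV. (\<Sum>s\<in>UNIV. ?N s i * ?D s r) * hess r j z - (\<Sum>s\<in>UNIV. ?D i s * ?N r s) * hess r j z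
      - ?H r * hess r j z + dir (ey i) Psi z * (snd z $ r * hess r j z) + (if r = i then Psi z else 0) * hess r j z
      - ?N r i * (\<Sum>s\<in>UNIV. ?D r s * hess s j z) - ?N r i * (\<Sum>s\<in>UNIV. ?D j s * hess r s z))"
  proof (rule sum.cong[OF refl])
    have alg: "(a1 - a2 - a3 + p * y + q) * t + n * (- b1 - b2) = a1 * t - a2 * t - a3 * t + p * (y * t) + q * t - n * b1 - n * b2"
      for a1 a2 a3 p y q t n b1 b2 :: real by (simp add: algebra_simps)
    show "dir (Xhat z) (dir (ey i) (spray F r)) z * hess r j z + ?N r i * dir (Xhat z) (hess r j) z =
      (\<Sum>s\<in>UNIV. ?N s i * ?D s r) * hess r j z - (\<Sum>s\<in>UNIV. ?D i s * ?N r s) * hess r j z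
      - ?H r * hess r j z + dir (ey i) Psi z * (snd z $ r * hess r j z) + (if r = i then Psi z else 0) * hess r j z
      - ?N r i * (\<Sum>s\<in>UNIV. ?D r s * hess s j z) - ?N r i * (\<Sum>s\<in>UNIV. ?D j s * hess r s z)" for r
      unfolding lie_spray1[OF z] lie_hess[OF z] by (rule alg)
  qed
  also have "\<dots> = (\<Sum>r\<in>UNIV. (\<Sum>s\<in>UNIV. ?N s i * ?D s r) * hess r j z) - (\<Sum>r\<in>UNIV. (\<Sum>s\<in>UNIV. ?D i s * ?N r s) * hess r j z)
      - (\<Sum>r\<in>UNIV. ?H r * hess r j z) + dir (ey i) Psi z * (\<Sum>r\<in>UNIV. snd z $ r * hess r j z) + (\<Sum>r\<in>UNIV. (if r = i then Psi z else 0) * hess r j z)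
      - (\<Sum>r\<in>UNIV. ?N r i * (\<Sum>s\<in>UNIV. ?D r s * hess s j z)) - (\<Sum>r\<in>UNIV. ?N r i * (\<Sum>s\<in>UNIV. ?D j s * hess r s z))"
    unfolding sum_distrib_left[of "dir (ey i) Psi z"] by (simp only: sum.distrib sum_subtractf)
  \<comment> \<open>The upper index of the connection and the lower index it is contracted with transform oppositely, so these terms cancel.\<close>
  also have "(\<Sum>r\<in>UNIV. ?N r i * (\<Sum>s\<in>UNIV. ?D r s * hess s j z)) = (\<Sum>r\<in>UNIV. (\<Sum>s\<in>UNIV. ?N s i * ?D s r) * hess r j z)"
    unfolding sum_distrib_left sum_distrib_right by (subst sum.swap) (simp add: mult.assoc)
  also have "(\<Sum>r\<in>UNIV. (\<Sum>s\<in>UNIV. ?D i s * ?N r s) * hess r j z) = (\<Sum>s\<in>UNIV. ?D i s * conn_hess s j z)"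
    unfolding conn_hess_def sum_distrib_left sum_distrib_right by (subst sum.swap) (simp add: mult.assoc)
  also have "(\<Sum>r\<in>UNIV. ?N r i * (\<Sum>s\<in>UNIV. ?D j s * hess r s z)) = (\<Sum>s\<in>UNIV. ?D j s * conn_hess i s z)"
    unfolding conn_hess_def sum_distrib_left sum_distrib_right by (subst sum.swap) (simp add: mult_ac)
  also have "(\<Sum>r\<in>UNIV. (if r = i then Psi z else 0) * hess r j z) = Psi z * hess i j z"
    by (simp add: if_distrib[of "\<lambda>x. x * _"] cong: if_cong)
  finally show ?thesis by (simp add: contract_hess[OF z])
qed

text \<open>The Hessian terms of \<open>X\<close> cancel between the derivative along the spray and the two connection terms, as they must for a
  tensor. The factors \<open>\<Psi>\<close> add up to \<open>2 - 1 - 1 = 0\<close>.\<close>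

lemma lie_hess_deriv: assumes z: "z \<in> Z" shows "lie_bilinear X hess_deriv i j z = 0"
proof -
  let ?H = "\<lambda>i r. \<Sum>k\<in>UNIV. snd z $ k * DDX i k r (fst z)"
  have x: "fst z \<in> U" using z by auto
  have SD: "dir (geod z) (\<lambda>w. DX i r (fst w)) z = ?H i r" for i r
  proof -
    have "dir (geod z) (\<lambda>w. DX i r (fst w)) z = dir (snd z) (DX i r) (fst z)"
      using dir_base[OF smooth_on_dir[OF smooth_X_nth] z] by (simp add: geod_def)
    also have "\<dots> = (\<Sum>k\<in>UNIV. snd z $ k * DDX k i r (fst z))"
      by (rule dir_vec_expand[OF smooth_on_differentiable[OF smooth_on_dir[OF smooth_X_nth] x]])
    also have "\<dots> = ?H i r"
      by (intro sum.cong refl arg_cong2[where f="(*)"] DDX_sym[OF x])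
    finally show ?thesis .
  qed
  have "dir (Xhat z) (\<lambda>w. dir (geod w) (hess i j) w) z = dir (geod z) (\<lambda>w. dir (Xhat w) (hess i j) w) z + 2 * Psi z * hess i j z"
    by (simp add: dir_Xhat_dir_geod[OF smooth_hess z] euler_hess[OF z])
  also have "dir (geod z) (\<lambda>w. dir (Xhat w) (hess i j) w) z =
      dir (geod z) (\<lambda>w. - (\<Sum>r\<in>UNIV. DX i r (fst w) * hess r j w) - (\<Sum>r\<in>UNIV. DX j r (fst w) * hess i r w)) z"
    by (rule dir_cong_Z[OF z lie_hess])
  also have "\<dots> = dir (geod z) (\<lambda>w. (- 1) * (\<Sum>r\<in>UNIV. DX i r (fst w) * hess r j w) - (\<Sum>r\<in>UNIV. DX j r (fst w) * hess i r w)) z"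
    by simp
  also have "\<dots> = - (\<Sum>r\<in>UNIV. ?H i r * hess r j z + DX i r (fst z) * dir (geod z) (hess r j) z)
        - (\<Sum>r\<in>UNIV. ?H j r * hess i r z + DX j r (fst z) * dir (geod z) (hess i r) z)"
    using z by (simp only: dir_diff dir_mult dir_sum dir_const diff_Z smooth_simps smooth_hess
      smooth_on_dir[OF smooth_X_nth] SD)
  finally have 1: "dir (Xhat z) (\<lambda>w. dir (geod w) (hess i j) w) z =
     - (\<Sum>r\<in>UNIV. ?H i r * hess r j z) - (\<Sum>r\<in>UNIV. DX i r (fst z) * dir (geod z) (hess r j) z)
     - (\<Sum>r\<in>UNIV. ?H j r * hess r i z) - (\<Sum>r\<in>UNIV. DX j r (fst z) * dir (geod z) (hess i r) z) + 2 * Psi z * hess i j z"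
    by (simp add: sum.distrib hess_sym[OF z, of i])
  have hess_deriv: "hess_deriv i j = (\<lambda>w. dir (geod w) (hess i j) w - conn_hess i j w - conn_hess j i w)" for i j
    by (simp add: fun_eq_iff hess_deriv_def conn_hess_def)
  have "complete_lift X (hess_deriv i j) z = dir (Xhat z) (\<lambda>w. dir (geod w) (hess i j) w) z - dir (Xhat z) (conn_hess i j) z - dir (Xhat z) (conn_hess j i) z"
    unfolding complete_lift_eq[OF smooth_hess_deriv z] unfolding hess_deriv
    using z by (simp add: dir_diff diff_Z smooth_dir_geod smooth_hess smooth_conn_hess smooth_on_diff[OF open_Z])
  also have "\<dots> = - (\<Sum>r\<in>UNIV. DX i r (fst z) * hess_deriv r j z) - (\<Sum>r\<in>UNIV. DX j r (fst z) * hess_deriv i r z)"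
    unfolding 1 lie_conn_hess[OF z] hess_deriv
    by (simp add: right_diff_distrib sum_subtractf hess_sym[OF z, of j i])
  finally show ?thesis by (simp add: lie_bilinear_def pderiv_at_eq_dir mult.commute)
qed

section \<open>The difference of the two Ricci tensors\<close>

abbreviation N :: "'n \<Rightarrow> 'n \<Rightarrow> (real^'n) \<times> (real^'n) \<Rightarrow> real" where "N r m \<equiv> dir (ey m) (spray F r)"

lemma smooth_N: "smooth_on Z (N r m)" by (intro smooth_on_dir smooth_spray)

text \<open>The four kinds of terms that occur in both Ricci tensors, apart from those built from \<open>hess\<close> and from mixed derivatives of
  the trace. All four are symmetric in \<open>i\<close> and \<open>j\<close>.\<close>

definition ddy_dx_spray where "ddy_dx_spray i j z = (\<Sum>m\<in>UNIV. dir (ey i) (dir (ey j) (dir (ex m) (spray F m))) z)"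
definition N_ddy_N where "N_ddy_N i j z = (\<Sum>m\<in>UNIV. \<Sum>r\<in>UNIV. N r m z * dir (ey i) (dir (ey j) (N m r)) z)"
definition dy_N_dy_N where "dy_N_dy_N i j z = (\<Sum>m\<in>UNIV. \<Sum>r\<in>UNIV. dir (ey i) (N m r) z * dir (ey j) (N r m) z)"
definition dy_trace_dy_N where "dy_trace_dy_N i j z = (\<Sum>r\<in>UNIV. dir (ey r) spray_trace z * dir (ey i) (N r j) z)"

lemma spray1_eq: "spray1 F i j = N i j" by (simp add: spray1_def dy_eq_dir)
lemma spray2_eq: "spray2 F i j k = dir (ey k) (N i j)" by (simp add: spray2_def spray1_eq dy_eq_dir)

lemma dir_spray_trace: "z \<in> Z \<Longrightarrow> dir v spray_trace z = (\<Sum>m\<in>UNIV. dir v (N m m) z)"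
  unfolding spray_trace_def[abs_def] by (rule dir_sum) (rule diff_Z[OF smooth_N])

lemma sum_spray2: assumes "z \<in> Z" shows "(\<Sum>m\<in>UNIV. dir (ey m) (N m j) z) = dir (ey j) spray_trace z"
  using dir_commute[OF open_Z smooth_spray assms] by (simp add: dir_spray_trace assms)

lemma dir_sum_spray2: assumes z: "z \<in> Z" shows "(\<Sum>m\<in>UNIV. dir v (dir (ey m) (N m j)) z) = dir v (dir (ey j) spray_trace) z"
proof -
  have "(\<Sum>m\<in>UNIV. dir v (dir (ey m) (N m j)) z) = dir v (\<lambda>w. \<Sum>m\<in>UNIV. dir (ey m) (N m j) w) z"
    by (rule dir_sum[symmetric]) (rule diff_Z[OF smooth_on_dir[OF smooth_N] z])
  also have "\<dots> = dir v (dir (ey j) spray_trace) z" by (rule dir_cong_Z[OF z sum_spray2])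
  finally show ?thesis .
qed

lemma berwald_contr_eq: assumes z: "z \<in> Z" shows
  "berwald_contr F j l z = ddy_dx_spray l j z - N_ddy_N l j z - dir (ex l) (dir (ey j) spray_trace) z + conn_hess l j z + dy_trace_dy_N l j z - dy_N_dy_N l j z"
proof -
  have "berwald_contr F j l z =
     (\<Sum>m\<in>UNIV. dir (ex m) (dir (ey l) (N m j)) z) - (\<Sum>m\<in>UNIV. \<Sum>r\<in>UNIV. N r m z * dir (ey r) (dir (ey l) (N m j)) z)
     - ((\<Sum>m\<in>UNIV. dir (ex l) (dir (ey m) (N m j)) z) - (\<Sum>m\<in>UNIV. \<Sum>r\<in>UNIV. N r l z * dir (ey r) (dir (ey m) (N m j)) z))
     + (\<Sum>m\<in>UNIV. \<Sum>r\<in>UNIV. dir (ey m) (N m r) z * dir (ey l) (N r j) z)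
     - (\<Sum>m\<in>UNIV. \<Sum>r\<in>UNIV. dir (ey l) (N m r) z * dir (ey m) (N r j) z)"
    by (simp only: berwald_contr_def berwald_curv_def hderiv_def spray1_eq spray2_eq dx_eq_dir dy_eq_dir sum.distrib sum_subtractf)
  also have "(\<Sum>m\<in>UNIV. dir (ex m) (dir (ey l) (N m j)) z) = ddy_dx_spray l j z"
    unfolding ddy_dx_spray_def by (intro sum.cong refl dir_rotate[OF smooth_spray z])
  also have "(\<Sum>m\<in>UNIV. \<Sum>r\<in>UNIV. N r m z * dir (ey r) (dir (ey l) (N m j)) z) = N_ddy_N l j z"
    unfolding N_ddy_N_def by (intro sum.cong refl arg_cong2[where f="(*)"] dir_rotate[OF smooth_spray z])
  also have "(\<Sum>m\<in>UNIV. dir (ex l) (dir (ey m) (N m j)) z) = dir (ex l) (dir (ey j) spray_trace) z"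
    by (rule dir_sum_spray2[OF z])
  also have "(\<Sum>m\<in>UNIV. \<Sum>r\<in>UNIV. N r l z * dir (ey r) (dir (ey m) (N m j)) z) = conn_hess l j z"
    unfolding conn_hess_def dir_sum_spray2[OF z, symmetric] sum_distrib_left by (rule sum.swap)
  also have "(\<Sum>m\<in>UNIV. \<Sum>r\<in>UNIV. dir (ey m) (N m r) z * dir (ey l) (N r j) z) = dy_trace_dy_N l j z"
    unfolding dy_trace_dy_N_def sum_spray2[OF z, symmetric] sum_distrib_right by (rule sum.swap)
  also have "(\<Sum>m\<in>UNIV. \<Sum>r\<in>UNIV. dir (ey l) (N m r) z * dir (ey m) (N r j) z) = dy_N_dy_N l j z"
    unfolding dy_N_dy_N_def by (intro sum.cong refl arg_cong2[where f="(*)"] dir_commute[OF open_Z smooth_spray z])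
  finally show ?thesis by simp
qed

lemma ddy_dx_spray_sym: "z \<in> Z \<Longrightarrow> ddy_dx_spray i j z = ddy_dx_spray j i z"
  unfolding ddy_dx_spray_def by (intro sum.cong refl dir_commute[OF open_Z smooth_on_dir[OF smooth_spray]])
lemma N_ddy_N_sym: "z \<in> Z \<Longrightarrow> N_ddy_N i j z = N_ddy_N j i z"
  unfolding N_ddy_N_def by (intro sum.cong refl arg_cong2[where f="(*)"] dir_commute[OF open_Z smooth_N])
lemma dy_trace_dy_N_sym: "z \<in> Z \<Longrightarrow> dy_trace_dy_N i j z = dy_trace_dy_N j i z"
  unfolding dy_trace_dy_N_def by (intro sum.cong refl arg_cong2[where f="(*)"] dir_commute[OF open_Z smooth_spray])
lemma dy_N_dy_N_sym: "dy_N_dy_N i j z = dy_N_dy_N j i z"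
  unfolding dy_N_dy_N_def by (subst sum.swap) (simp add: mult.commute)

lemma first_Ricci_eq: assumes z: "z \<in> Z" shows
  "first_Ricci F i j z = ddy_dx_spray i j z - N_ddy_N i j z + dy_trace_dy_N i j z - dy_N_dy_N i j z
     - 1/2 * (dir (ex i) (dir (ey j) spray_trace) z + dir (ex j) (dir (ey i) spray_trace) z) + 1/2 * (conn_hess i j z + conn_hess j i z)"
  unfolding first_Ricci_def berwald_contr_eq[OF z] ddy_dx_spray_sym[OF z, of j i] N_ddy_N_sym[OF z, of j i] dy_trace_dy_N_sym[OF z, of j i] dy_N_dy_N_sym[of j i]
  by (simp add: field_simps)

text \<open>The four summands of the Ricci scalar \<open>R\<^sup>m\<^sub>m\<close>, up to constant factors.\<close>

definition riem_dx_spray where "riem_dx_spray z = (\<Sum>m\<in>UNIV. dir (ex m) (spray F m) z)"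
definition riem_dx_trace where "riem_dx_trace z = (\<Sum>k\<in>UNIV. snd z $ k * dir (ex k) spray_trace z)"
definition riem_dy_trace where "riem_dy_trace z = (\<Sum>k\<in>UNIV. spray F k z * dir (ey k) spray_trace z)"
definition riem_N_N where "riem_N_N z = (\<Sum>m\<in>UNIV. \<Sum>k\<in>UNIV. N m k z * N k m z)"

lemma smooth_riem: "smooth_on Z riem_dx_spray" "smooth_on Z riem_dx_trace" "smooth_on Z riem_dy_trace" "smooth_on Z riem_N_N"
  unfolding riem_dx_spray_def[abs_def] riem_dx_trace_def[abs_def] riem_dy_trace_def[abs_def] riem_N_N_def[abs_def]
  by (intro smooth_on_sum[OF open_Z] smooth_on_mult[OF open_Z] smooth_on_dir smooth_y smooth_spray smooth_spray_trace)+

lemma riemann_trace: assumes z: "z \<in> Z" shows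
  "(\<Sum>m\<in>UNIV. riemann_curv F m m z) = 2 * riem_dx_spray z - riem_dx_trace z + 2 * riem_dy_trace z - riem_N_N z"
proof -
  have "(\<Sum>m\<in>UNIV. \<Sum>j\<in>UNIV. dir (ex j) (N m m) z * snd z $ j) = riem_dx_trace z"
    unfolding riem_dx_trace_def dir_spray_trace[OF z] sum_distrib_left by (subst sum.swap) (simp add: mult.commute)
  moreover have "(\<Sum>m\<in>UNIV. \<Sum>j\<in>UNIV. spray F j z * dir (ey j) (N m m) z) = riem_dy_trace z"
    unfolding riem_dy_trace_def dir_spray_trace[OF z] sum_distrib_left by (rule sum.swap)
  ultimately show ?thesis
    unfolding riemann_curv_def dx_eq_dir dy_eq_dir riem_dx_spray_def riem_N_N_def
    by (simp add: sum.distrib sum_subtractf flip: sum_distrib_left)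
qed

lemma second_Ricci_eq_riem: assumes z: "z \<in> Z" shows
  "second_Ricci F i j z = dir (ey i) (dir (ey j) riem_dx_spray) z - 1/2 * dir (ey i) (dir (ey j) riem_dx_trace) z
     + dir (ey i) (dir (ey j) riem_dy_trace) z - 1/2 * dir (ey i) (dir (ey j) riem_N_N) z"
proof -
  have "dir (ey i) (dir (ey j) (\<lambda>w. \<Sum>m\<in>UNIV. riemann_curv F m m w)) z =
     dir (ey i) (dir (ey j) (\<lambda>w. 2 * riem_dx_spray w - riem_dx_trace w + 2 * riem_dy_trace w - riem_N_N w)) z"
    by (rule dir_cong_Z[OF z dir_cong_Z[OF _ riemann_trace]])
  also have "\<dots> = 2 * dir (ey i) (dir (ey j) riem_dx_spray) z - dir (ey i) (dir (ey j) riem_dx_trace) z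
     + 2 * dir (ey i) (dir (ey j) riem_dy_trace) z - dir (ey i) (dir (ey j) riem_N_N) z"
    by (rule dir_dir_combination[OF smooth_riem z])
  finally show ?thesis by (simp add: second_Ricci_def dy_eq_dir)
qed

lemma smooth_second_Ricci: "smooth_on Z (second_Ricci F i j)"
proof (rule smooth_on_cong[OF open_Z second_Ricci_eq_riem[symmetric]])
  show "smooth_on Z (\<lambda>z. dir (ey i) (dir (ey j) riem_dx_spray) z - 1/2 * dir (ey i) (dir (ey j) riem_dx_trace) z
     + dir (ey i) (dir (ey j) riem_dy_trace) z - 1/2 * dir (ey i) (dir (ey j) riem_N_N) z)"
    by (intro smooth_simps smooth_riem)
qed

text \<open>Leibniz' rule, with the order of derivatives arranged as in the expansion of the first Ricci tensor.\<close>

lemma dir_dir_riem: assumes z: "z \<in> Z" shows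
  "dir (ey i) (dir (ey j) riem_dx_spray) z = ddy_dx_spray i j z"
  "dir (ey i) (dir (ey j) riem_dx_trace) z = dir (ex i) (dir (ey j) spray_trace) z + dir (ex j) (dir (ey i) spray_trace) z
     + (\<Sum>k\<in>UNIV. snd z $ k * dir (ex k) (hess i j) z)"
  "dir (ey i) (dir (ey j) riem_dy_trace) z = dy_trace_dy_N i j z + conn_hess i j z + conn_hess j i z + (\<Sum>k\<in>UNIV. spray F k z * dir (ey k) (hess i j) z)"
  "dir (ey i) (dir (ey j) riem_N_N) z = 2 * N_ddy_N i j z + 2 * dy_N_dy_N i j z"
proof -
  show "dir (ey i) (dir (ey j) riem_dx_spray) z = ddy_dx_spray i j z"
    unfolding riem_dx_spray_def[abs_def] ddy_dx_spray_def by (rule dir_dir_sum[OF smooth_on_dir[OF smooth_spray] z])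
  have ax: "(\<Sum>k\<in>UNIV. axis l 1 $ k * h k) = h l" for h :: "'n \<Rightarrow> real" and l
    by (simp add: axis_def if_distrib[of "\<lambda>x. x * _"] cong: if_cong)
  have y0: "dir v (dir u (\<lambda>w. snd w $ k)) z = 0" for u v k
  proof -
    have "dir u (\<lambda>w::(real^'n) \<times> (real^'n). snd w $ k) = (\<lambda>w. snd u $ k)" by (rule ext) (rule dir_y)
    then show ?thesis by simp
  qed
  have "dir (ey i) (dir (ey j) riem_dx_trace) z = (\<Sum>k\<in>UNIV. axis j 1 $ k * dir (ey i) (dir (ex k) spray_trace) z)
      + (\<Sum>k\<in>UNIV. axis i 1 $ k * dir (ey j) (dir (ex k) spray_trace) z) + (\<Sum>k\<in>UNIV. snd z $ k * dir (ey i) (dir (ey j) (dir (ex k) spray_trace)) z)"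
    unfolding riem_dx_trace_def[abs_def]
    by (simp add: dir_dir_sum[OF smooth_on_mult[OF open_Z smooth_y smooth_on_dir[OF smooth_spray_trace]] z]
        dir_dir_mult[OF smooth_y smooth_on_dir[OF smooth_spray_trace] z] dir_y y0 sum.distrib)
  then show "dir (ey i) (dir (ey j) riem_dx_trace) z = dir (ex i) (dir (ey j) spray_trace) z + dir (ex j) (dir (ey i) spray_trace) z
     + (\<Sum>k\<in>UNIV. snd z $ k * dir (ex k) (hess i j) z)"
    using dir_commute[OF open_Z smooth_spray_trace z, of "ey i" "ex j"] dir_commute[OF open_Z smooth_spray_trace z, of "ey j" "ex i"]
    by (simp add: ax dir_rotate[OF smooth_spray_trace z, of "ex _"])
  have "dir (ey i) (dir (ey j) riem_dy_trace) z = (\<Sum>k\<in>UNIV. dir (ey i) (N k j) z * dir (ey k) spray_trace z + N k j z * hess i k z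
      + N k i z * hess j k z + spray F k z * dir (ey i) (dir (ey j) (dir (ey k) spray_trace)) z)"
    unfolding riem_dy_trace_def[abs_def]
    by (simp only: dir_dir_sum[OF smooth_on_mult[OF open_Z smooth_spray smooth_on_dir[OF smooth_spray_trace]] z]
        dir_dir_mult[OF smooth_spray smooth_on_dir[OF smooth_spray_trace] z])
  then show "dir (ey i) (dir (ey j) riem_dy_trace) z = dy_trace_dy_N i j z + conn_hess i j z + conn_hess j i z + (\<Sum>k\<in>UNIV. spray F k z * dir (ey k) (hess i j) z)"
    by (simp add: dy_trace_dy_N_def conn_hess_def sum.distrib mult.commute hess_sym[OF z, of i] hess_sym[OF z, of j] dir_rotate[OF smooth_spray_trace z, of "ey _" "ey i" "ey j"])
  have "dir (ey i) (dir (ey j) riem_N_N) z = (\<Sum>m\<in>UNIV. \<Sum>k\<in>UNIV. dir (ey i) (dir (ey j) (N m k)) z * N k m z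
     + dir (ey j) (N m k) z * dir (ey i) (N k m) z + dir (ey i) (N m k) z * dir (ey j) (N k m) z
     + N m k z * dir (ey i) (dir (ey j) (N k m)) z)"
    unfolding riem_N_N_def[abs_def]
    by (simp only: dir_dir_sum[OF smooth_on_sum[OF open_Z smooth_on_mult[OF open_Z smooth_N smooth_N]] z]
        dir_dir_sum[OF smooth_on_mult[OF open_Z smooth_N smooth_N] z] dir_dir_mult[OF smooth_N smooth_N z])
  also have "\<dots> = N_ddy_N i j z + dy_N_dy_N j i z + dy_N_dy_N i j z + (\<Sum>m\<in>UNIV. \<Sum>k\<in>UNIV. N m k z * dir (ey i) (dir (ey j) (N k m)) z)"
    by (simp add: N_ddy_N_def dy_N_dy_N_def sum.distrib mult.commute)
  also have "(\<Sum>m\<in>UNIV. \<Sum>k\<in>UNIV. N m k z * dir (ey i) (dir (ey j) (N k m)) z) = N_ddy_N i j z"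
    unfolding N_ddy_N_def by (rule sum.swap)
  finally show "dir (ey i) (dir (ey j) riem_N_N) z = 2 * N_ddy_N i j z + 2 * dy_N_dy_N i j z" using dy_N_dy_N_sym[of i j] by simp
qed

text \<open>Comparing the two expansions, what survives are the terms in which \<open>hess\<close> is differentiated along the spray and half of
  each connection term.\<close>

lemma Ricci_difference: assumes z: "z \<in> Z" shows "second_Ricci F i j z = first_Ricci F i j z - 1/2 * hess_deriv i j z"
proof -
  have "hess_deriv i j z = (\<Sum>k\<in>UNIV. snd z $ k * dir (ex k) (hess i j) z) - 2 * (\<Sum>k\<in>UNIV. spray F k z * dir (ey k) (hess i j) z)
      - conn_hess i j z - conn_hess j i z"
    by (simp add: hess_deriv_def conn_hess_def dir_geod[OF smooth_hess z])
  then show ?thesis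
    by (simp add: second_Ricci_eq_riem[OF z] first_Ricci_eq[OF z] dir_dir_riem[OF z] field_simps)
qed

lemma smooth_first_Ricci: "smooth_on Z (first_Ricci F i j)"
proof (rule smooth_on_cong[OF open_Z])
  show "smooth_on Z (\<lambda>z. second_Ricci F i j z + 1/2 * hess_deriv i j z)" by (intro smooth_simps smooth_second_Ricci smooth_hess_deriv)
qed (simp add: Ricci_difference)

lemma lie_Ricci_eq: assumes z: "z \<in> Z"
  shows "lie_bilinear X (second_Ricci F) i j z = lie_bilinear X (first_Ricci F) i j z"
proof -
  have "complete_lift X (second_Ricci F i j) z = dir (Xhat z) (\<lambda>w. first_Ricci F i j w - 1/2 * hess_deriv i j w) z"
    unfolding complete_lift_eq[OF smooth_second_Ricci z] by (rule dir_cong_Z[OF z Ricci_difference])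
  also have "\<dots> = complete_lift X (first_Ricci F i j) z - 1/2 * complete_lift X (hess_deriv i j) z"
    using z by (simp add: complete_lift_eq smooth_first_Ricci smooth_hess_deriv dir_diff dir_divide_const diff_Z smooth_simps)
  finally have "lie_bilinear X (second_Ricci F) i j z = lie_bilinear X (first_Ricci F) i j z - 1/2 * lie_bilinear X hess_deriv i j z"
    by (simp add: lie_bilinear_def Ricci_difference[OF z] left_diff_distrib sum_subtractf sum_divide_distrib add_divide_distrib)
  then show ?thesis using lie_hess_deriv[OF z] by simp
qed

end

section \<open>From charts to the manifold\<close>

text \<open>Fibre coordinates are linear, because components in other charts are obtained by Jacobians; so homogeneity on the
  tangent bundle becomes homogeneity in \<open>y\<close>.\<close>

lemma bundle_point_scale:
  assumes M: "smooth_manifold M A" and c: "c \<in> A" and x: "x \<in> chart_image c"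
  shows "bundle_point A c (x, s *\<^sub>R y) = (fst (bundle_point A c (x, y)), scale_tvec s (snd (bundle_point A c (x, y))))"
proof -
  have ch: "is_chart M c" using M c by (auto simp: smooth_manifold_def)
  have "frechet_derivative (transition c d) (at x) (s *\<^sub>R y) = s *\<^sub>R frechet_derivative (transition c d) (at x) y"
    if "d \<in> A" "chart_point c x \<in> fst d" for d
  proof -
    have "transition c d differentiable (at x)"
      using transition_differentiable[OF M c that(1) chart_point_simps(4)[OF ch x] that(2)] chart_point_simps(3)[OF ch x] by simp
    then show ?thesis using linear_frechet_derivative linear_cmul by blast
  qed
  then show ?thesis by (simp add: bundle_point_def scale_tvec_def fun_eq_iff)
qed

theorem lemma4:
  fixes M :: "'m topology"
    and A :: "('m, 'n::finite) chart set"
    and F :: "'m \<times> ('m, 'n) tvec \<Rightarrow> real"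
    and X :: "'m \<Rightarrow> ('m, 'n) tvec"
  assumes "smooth_manifold M A"
    and "finsler_structure M A F"
    and "I_projective_field M A F X"
  shows "\<forall>c\<in>A. \<forall>z\<in>slit_coords c. \<forall>i j.
    lie_bilinear (field_rep c X) (second_Ricci (local_rep A c F)) i j z =
    lie_bilinear (field_rep c X) (first_Ricci (local_rep A c F)) i j z"
proof (intro ballI allI)
  fix c z i j assume c: "c \<in> A" and z: "z \<in> slit_coords c"
  have proj: "projective_field M A F X" using assms(3) by (simp add: I_projective_field_def)
  then obtain \<Psi> where Psi: "\<forall>(p, v)\<in>slit_tangent_bundle M A. \<forall>s>0. \<Psi> (p, scale_tvec s v) = s * \<Psi> (p, v)"
    "\<forall>c\<in>A. \<forall>z\<in>slit_coords c. \<forall>i.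
         lie_spray (field_rep c X) (spray (local_rep A c F)) i z = local_rep A c \<Psi> z * snd z $ i"
    unfolding projective_field_def by blast
  have fin: "\<forall>(p, v)\<in>tangent_bundle M A. \<forall>s>0. F (p, scale_tvec s v) = s * F (p, v)"
    "\<forall>c\<in>A. smooth_on (slit_coords c) (local_rep A c F)"
    "\<forall>c\<in>A. \<forall>z\<in>slit_coords c. \<forall>w. w \<noteq> 0 \<longrightarrow> (\<Sum>i\<in>UNIV. \<Sum>j\<in>UNIV. fund (local_rep A c F) i j z * w $ i * w $ j) > 0"
    using assms(2) unfolding finsler_structure_def by blast+
  have scale: "bundle_point A c (fst w, s *\<^sub>R snd w) = (fst (bundle_point A c w), scale_tvec s (snd (bundle_point A c w)))"
    and tb: "bundle_point A c w \<in> tangent_bundle M A" and slit: "bundle_point A c w \<in> slit_tangent_bundle M A"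
    if w: "w \<in> chart_image c \<times> (UNIV - {0})" for w s
  proof -
    obtain x y where xy: "w = (x, y)" "x \<in> chart_image c" "y \<noteq> 0" using w by auto
    show "bundle_point A c (fst w, s *\<^sub>R snd w) = (fst (bundle_point A c w), scale_tvec s (snd (bundle_point A c w)))"
      using bundle_point_scale[OF assms(1) c xy(2)] xy(1) by simp
    show tb: "bundle_point A c w \<in> tangent_bundle M A" using bundle_point_coord(2)[OF assms(1) c xy(2)] xy(1) by simp
    have "snd (bundle_point A c w) c \<noteq> 0" using bundle_point_coord(1)[OF assms(1) c xy(2)] xy by simp
    then have "snd (bundle_point A c w) \<noteq> (\<lambda>_. 0)" by metis
    then show "bundle_point A c w \<in> slit_tangent_bundle M A" using tb by (simp add: slit_tangent_bundle_def case_prod_beta)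
  qed
  interpret I_projective_chart "chart_image c" "local_rep A c F" "field_rep c X" "local_rep A c \<Psi>"
  proof
    show "open (chart_image c)" using assms(1) c by (auto simp: smooth_manifold_def is_chart_def)
    show "smooth_on (chart_image c \<times> (UNIV - {0})) (local_rep A c F)" using fin(2) c by (simp add: slit_coords_def)
    show "smooth_on (chart_image c) (field_rep c X)" using proj c by (simp add: projective_field_def smooth_vector_field_def)
    fix w :: "(real^'n) \<times> (real^'n)" assume w: "w \<in> chart_image c \<times> (UNIV - {0})"
    then have w': "w \<in> slit_coords c" by (simp add: slit_coords_def)
    show "local_rep A c F (fst w, s *\<^sub>R snd w) = s * local_rep A c F w" if "s > 0" for s
      using fin(1) tb[OF w] that by (auto simp: local_rep_def scale[OF w] split: prod.splits)
    show "local_rep A c \<Psi> (fst w, s *\<^sub>R snd w) = s * local_rep A c \<Psi> w" if "s > 0" for s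
      using Psi(1) slit[OF w] that by (auto simp: local_rep_def scale[OF w] split: prod.splits)
    show "(\<Sum>i\<in>UNIV. \<Sum>j\<in>UNIV. fund (local_rep A c F) i j w * v $ i * v $ j) > 0" if "v \<noteq> 0" for v
      using fin(3) c w' that by blast
    show "lie_spray (field_rep c X) (spray (local_rep A c F)) i w = local_rep A c \<Psi> w * snd w $ i" for i
      using Psi(2) c w' by blast
    show "lie_covector (field_rep c X) (mean_Cartan (local_rep A c F)) i w = 0" for i
      using assms(3) c w' by (simp add: I_projective_field_def)
  qed
  show "lie_bilinear (field_rep c X) (second_Ricci (local_rep A c F)) i j z =
    lie_bilinear (field_rep c X) (first_Ricci (local_rep A c F)) i j z"
    using lie_Ricci_eq z by (simp add: slit_coords_def)
qed

end
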